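(* The spectrum of the Hilbert matrix $H$, regarded as a bounded linear operator on $\ell^2$, is the interval $[0,\pi]$, and $H$ has no eigenvalues (its point spectrum is empty).
   Context: $H=\left(\frac{1}{i+j+1}\right)_{i,j\ge 0}$ is the (infinite) Hilbert matrix, acting on $\ell^2$ (square-summable complex sequences indexed by $n\ge 0$) by $(Hx)_i=\sum_{j=0}^\infty\frac{x_j}{i+j+1}$, $i\ge 0$; it defines a bounded linear operator on $\ell^2$. *)

theory Defs
  imports "HOL-Analysis.Analysis"
begin

section \<open>The space of square-summable complex sequences\<close>

lemma summable_norm_add_squares:
  fixes x y :: "nat \<Rightarrow> complex"
  assumes "summable (\<lambda>n. (norm (x n))\<^sup>2)" "summable (\<lambda>n. (norm (y n))\<^sup>2)"
  shows "summable (\<lambda>n. (norm (x n + y n))\<^sup>2)"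
proof (rule summable_comparison_test')
  show "summable (\<lambda>n. 2 * (norm (x n))\<^sup>2 + 2 * (norm (y n))\<^sup>2)"
    using assms by (intro summable_add summable_mult)
  fix n
  have "(norm (x n + y n))\<^sup>2 \<le> (norm (x n) + norm (y n))\<^sup>2"
    by (intro power_mono norm_triangle_ineq) auto
  also have "\<dots> \<le> 2 * (norm (x n))\<^sup>2 + 2 * (norm (y n))\<^sup>2"
    using sum_squares_ge_zero[of "norm (x n) - norm (y n)" 0]
    by (simp add: power2_eq_square algebra_simps)
  finally show "norm ((norm (x n + y n))\<^sup>2) \<le> 2 * (norm (x n))\<^sup>2 + 2 * (norm (y n))\<^sup>2"
    by simp
qed

lemma summable_inner_of_squares:
  fixes x y :: "nat \<Rightarrow> complex"
  assumes "summable (\<lambda>n. (norm (x n))\<^sup>2)" "summable (\<lambda>n. (norm (y n))\<^sup>2)"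
  shows "summable (\<lambda>n. x n \<bullet> y n)"
proof (rule summable_comparison_test')
  show "summable (\<lambda>n. (norm (x n))\<^sup>2 + (norm (y n))\<^sup>2)"
    using assms by (rule summable_add)
  fix n
  have "norm (x n \<bullet> y n) \<le> norm (x n) * norm (y n)"
    by (simp add: Cauchy_Schwarz_ineq2)
  also have "\<dots> \<le> (norm (x n))\<^sup>2 + (norm (y n))\<^sup>2"
  proof -
    have "2 * (norm (x n) * norm (y n)) \<le> (norm (x n))\<^sup>2 + (norm (y n))\<^sup>2"
      using sum_squares_ge_zero[of "norm (x n) - norm (y n)" 0]
      by (simp add: power2_eq_square algebra_simps)
    moreover have "0 \<le> norm (x n) * norm (y n)" by simp
    ultimately show ?thesis by linarith
  qed
  finally show "norm (x n \<bullet> y n) \<le> (norm (x n))\<^sup>2 + (norm (y n))\<^sup>2" .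
qed

typedef ell2 = "{x :: nat \<Rightarrow> complex. summable (\<lambda>n. (norm (x n))\<^sup>2)}"
  morphisms ell2_coord Abs_ell2
  by (rule exI[of _ "\<lambda>_. 0"]) simp

setup_lifting type_definition_ell2

lift_definition scaleC :: "complex \<Rightarrow> ell2 \<Rightarrow> ell2" (infixr "*\<^sub>C" 75)
  is "\<lambda>c x n. c * x n"
  by (simp add: norm_mult power_mult_distrib summable_mult)

instantiation ell2 :: real_vector
begin

lift_definition zero_ell2 :: ell2 is "\<lambda>_. 0" by simp

lift_definition plus_ell2 :: "ell2 \<Rightarrow> ell2 \<Rightarrow> ell2" is "\<lambda>x y n. x n + y n"
  by (rule summable_norm_add_squares)

lift_definition uminus_ell2 :: "ell2 \<Rightarrow> ell2" is "\<lambda>x n. - x n" by simp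

lift_definition minus_ell2 :: "ell2 \<Rightarrow> ell2 \<Rightarrow> ell2" is "\<lambda>x y n. x n - y n"
proof -
  fix x y :: "nat \<Rightarrow> complex"
  assume "summable (\<lambda>n. (norm (x n))\<^sup>2)" "summable (\<lambda>n. (norm (y n))\<^sup>2)"
  then show "summable (\<lambda>n. (norm (x n - y n))\<^sup>2)"
    using summable_norm_add_squares[of x "\<lambda>n. - y n"] by simp
qed

lift_definition scaleR_ell2 :: "real \<Rightarrow> ell2 \<Rightarrow> ell2" is "\<lambda>r x n. r *\<^sub>R x n"
  by (simp add: power_mult_distrib summable_mult)

instance
  by standard (transfer; simp add: fun_eq_iff algebra_simps)+

end

text \<open>
  The class \<^class>\<open>real_inner\<close> asks for a real inner product; on \<open>\<ell>\<^sup>2\<close> it is the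
  real part of the usual Hermitian one, and it induces the usual norm.
\<close>

instantiation ell2 :: real_inner
begin

lift_definition inner_ell2 :: "ell2 \<Rightarrow> ell2 \<Rightarrow> real" is "\<lambda>x y. \<Sum>n. x n \<bullet> y n" .

lift_definition norm_ell2 :: "ell2 \<Rightarrow> real" is "\<lambda>x. sqrt (\<Sum>n. (norm (x n))\<^sup>2)" .

definition sgn_ell2 :: "ell2 \<Rightarrow> ell2" where "sgn_ell2 x = x /\<^sub>R norm x"

definition dist_ell2 :: "ell2 \<Rightarrow> ell2 \<Rightarrow> real" where "dist_ell2 x y = norm (x - y)"

definition uniformity_ell2 :: "(ell2 \<times> ell2) filter"
  where "uniformity_ell2 = (INF e\<in>{0<..}. principal {(x, y). dist x y < e})"

definition open_ell2 :: "ell2 set \<Rightarrow> bool"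
  where "open_ell2 U \<longleftrightarrow> (\<forall>x\<in>U. eventually (\<lambda>(x', y). x' = x \<longrightarrow> y \<in> U) uniformity)"

instance
proof
  fix x y z :: ell2 and r :: real and U :: "ell2 set"
  show "dist x y = norm (x - y)" by (rule dist_ell2_def)
  show "sgn x = x /\<^sub>R norm x" by (rule sgn_ell2_def)
  show "(uniformity :: (ell2 \<times> ell2) filter) = (INF e\<in>{0<..}. principal {(x, y). dist x y < e})"
    by (rule uniformity_ell2_def)
  show "open U \<longleftrightarrow> (\<forall>x\<in>U. eventually (\<lambda>(x', y). x' = x \<longrightarrow> y \<in> U) uniformity)"
    by (rule open_ell2_def)
  show "x \<bullet> y = y \<bullet> x"
    by transfer (simp add: inner_commute)
  show "(x + y) \<bullet> z = x \<bullet> z + y \<bullet> z"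
    by transfer (simp add: inner_add_left suminf_add summable_inner_of_squares)
  show "(r *\<^sub>R x) \<bullet> y = r * (x \<bullet> y)"
    by transfer (simp add: suminf_mult summable_inner_of_squares del: inner_complex_def)
  show "0 \<le> x \<bullet> x"
    by transfer (simp add: suminf_nonneg summable_inner_of_squares)
  show "x \<bullet> x = 0 \<longleftrightarrow> x = 0"
    by transfer (simp add: suminf_eq_zero_iff summable_inner_of_squares fun_eq_iff)
  show "norm x = sqrt (x \<bullet> x)"
    by transfer (simp add: power2_norm_eq_inner)
qed

end


section \<open>Bounded operators and their spectra\<close>

definition bounded_clinear :: "(ell2 \<Rightarrow> ell2) \<Rightarrow> bool"
  where "bounded_clinear T \<longleftrightarrow> bounded_linear T \<and> (\<forall>c x. T (c *\<^sub>C x) = c *\<^sub>C T x)"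

definition resolvent_set :: "(ell2 \<Rightarrow> ell2) \<Rightarrow> complex set"
  where "resolvent_set T =
    {l. \<exists>S. bounded_clinear S \<and>
      (\<forall>x. S (T x - l *\<^sub>C x) = x) \<and> (\<forall>x. T (S x) - l *\<^sub>C S x = x)}"

definition spectrum :: "(ell2 \<Rightarrow> ell2) \<Rightarrow> complex set"
  where "spectrum T = - resolvent_set T"

definition point_spectrum :: "(ell2 \<Rightarrow> ell2) \<Rightarrow> complex set"
  where "point_spectrum T = {l. \<exists>x. x \<noteq> 0 \<and> T x = l *\<^sub>C x}"


section \<open>The Hilbert matrix\<close>

text \<open>
  To see that the matrix maps \<open>\<ell>\<^sup>2\<close> to itself, use the Schur test with the weights
  \<open>1 / sqrt (j + 1)\<close>.
\<close>

lemma hilbert_schur_row: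
  "(\<Sum>j<M. 1 / (real (i + j + 1) * sqrt (real (j + 1)))) \<le> 8 / sqrt (real (i + 1))"
proof -
  define r where "r = sqrt (real (i + 1))"
  have r: "r > 0" "r\<^sup>2 = real (i + 1)" by (auto simp: r_def)
  define h where "h = (\<lambda>j::nat. 8 * sqrt (real j) / (r * (r + sqrt (real j))))"
  have step: "1 / (real (i + j + 1) * sqrt (real (j + 1))) \<le> h (Suc j) - h j" for j
  proof -
    define s t where "s = sqrt (real j)" and "t = sqrt (real (j + 1))"
    have st: "0 \<le> s" "s \<le> t" "0 < t" "s\<^sup>2 = real j" "t\<^sup>2 = real j + 1"
      by (auto simp: s_def t_def)
    define D where "D = (r + t) * (r + s) * (t + s)"
    have D: "D > 0" unfolding D_def using r st by simp
    have ts: "(t - s) * (t + s) = 1"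
      using st by (simp add: power2_eq_square algebra_simps)
    have "h (Suc j) - h j = 8 * t / (r * (r + t)) - 8 * s / (r * (r + s))"
      by (simp add: h_def s_def t_def add.commute)
    also have "\<dots> = 8 * (t - s) / ((r + t) * (r + s))"
    proof -
      have "r + t \<noteq> 0" "r + s \<noteq> 0" "r \<noteq> 0" using r st by linarith+
      then show ?thesis by (simp add: divide_simps) (simp add: algebra_simps)
    qed
    also have "\<dots> = 8 * ((t - s) * (t + s)) / D"
      unfolding D_def using st by simp
    also have "\<dots> = 8 / D" using ts by simp
    finally have h: "h (Suc j) - h j = 8 / D" .
    have "D \<le> (r + t) * (r + t) * (t + t)"
      unfolding D_def using r st by (intro mult_mono) auto
    also have "(r + t) * (r + t) \<le> 2 * (r\<^sup>2 + t\<^sup>2)"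
      using sum_squares_ge_zero[of "r - t" 0] by (simp add: power2_eq_square algebra_simps)
    also have "2 * (r\<^sup>2 + t\<^sup>2) \<le> 4 * real (i + j + 1)"
      using r st by simp
    finally have "D \<le> 8 * (real (i + j + 1) * t)"
      using st by (simp add: mult_right_mono algebra_simps)
    then have "8 / (8 * (real (i + j + 1) * t)) \<le> 8 / D"
      using D by (intro divide_left_mono) (auto intro!: mult_pos_pos st)
    then show ?thesis unfolding h by (simp add: t_def)
  qed
  have "(\<Sum>j<M. 1 / (real (i + j + 1) * sqrt (real (j + 1)))) \<le> (\<Sum>j<M. h (Suc j) - h j)"
    by (intro sum_mono step)
  also have "\<dots> = h M - h 0" by (rule sum_lessThan_telescope)
  also have "\<dots> = 8 * (sqrt (real M) / (r + sqrt (real M))) / r"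
    by (simp add: h_def)
  also have "\<dots> \<le> 8 * 1 / r"
  proof -
    have "r + sqrt (real M) > 0" using r by (simp add: add_pos_nonneg)
    then have "sqrt (real M) / (r + sqrt (real M)) \<le> 1" using r by simp
    then show ?thesis using r by (intro divide_right_mono mult_left_mono) auto
  qed
  finally show ?thesis by (simp add: r_def)
qed

lemma hilbert_finite_bound:
  fixes a :: "nat \<Rightarrow> real"
  assumes "\<And>j. 0 \<le> a j"
  shows "(\<Sum>i<N. (\<Sum>j<M. a j / real (i + j + 1))\<^sup>2) \<le> 64 * (\<Sum>j<M. (a j)\<^sup>2)"
proof -
  define w where "w = (\<lambda>j::nat. 1 / sqrt (real (j + 1)))"
  define K where "K = (\<lambda>i j::nat. 1 / real (i + j + 1))"
  have w: "w j > 0" for j by (simp add: w_def)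
  have K: "K i j > 0" for i j by (simp add: K_def)
  have row: "(\<Sum>j<M. K i j * w j) \<le> 8 * w i" for i M
    using hilbert_schur_row[of i M] by (simp add: K_def w_def)
  have col: "(\<Sum>i<N. K i j * w i) \<le> 8 * w j" for j
    using row[of j N] by (simp add: K_def add.commute)
  have cs: "(\<Sum>j<M. K i j * a j)\<^sup>2 \<le> 8 * w i * (\<Sum>j<M. K i j * (a j)\<^sup>2 / w j)" for i
  proof -
    have "(\<Sum>j<M. K i j * a j)\<^sup>2
        = (\<Sum>j<M. sqrt (K i j * w j) * sqrt (K i j * (a j)\<^sup>2 / w j))\<^sup>2"
    proof (intro arg_cong[where f = "\<lambda>x. x\<^sup>2"] sum.cong refl)
      fix j
      have "sqrt (K i j * w j) * sqrt (K i j * (a j)\<^sup>2 / w j) = sqrt ((K i j * a j)\<^sup>2)"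
        using w[of j] by (simp add: real_sqrt_mult[symmetric] power2_eq_square algebra_simps)
      then show "K i j * a j = sqrt (K i j * w j) * sqrt (K i j * (a j)\<^sup>2 / w j)"
        using K[of i j] assms[of j] by simp
    qed
    also have "\<dots> \<le> (\<Sum>j<M. (sqrt (K i j * w j))\<^sup>2) * (\<Sum>j<M. (sqrt (K i j * (a j)\<^sup>2 / w j))\<^sup>2)"
      by (rule Cauchy_Schwarz_ineq_sum)
    also have "\<dots> = (\<Sum>j<M. K i j * w j) * (\<Sum>j<M. K i j * (a j)\<^sup>2 / w j)"
      using w K by (simp add: less_imp_le)
    also have "\<dots> \<le> 8 * w i * (\<Sum>j<M. K i j * (a j)\<^sup>2 / w j)"
      using row w K by (intro mult_right_mono sum_nonneg) (auto simp: less_imp_le)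
    finally show ?thesis .
  qed
  have "(\<Sum>i<N. (\<Sum>j<M. K i j * a j)\<^sup>2) \<le> (\<Sum>i<N. 8 * w i * (\<Sum>j<M. K i j * (a j)\<^sup>2 / w j))"
    by (intro sum_mono cs)
  also have "\<dots> = (\<Sum>i<N. \<Sum>j<M. (8 * (a j)\<^sup>2 / w j) * (K i j * w i))"
    by (simp add: sum_distrib_left algebra_simps)
  also have "\<dots> = (\<Sum>j<M. \<Sum>i<N. (8 * (a j)\<^sup>2 / w j) * (K i j * w i))"
    by (rule sum.swap)
  also have "\<dots> = (\<Sum>j<M. (8 * (a j)\<^sup>2 / w j) * (\<Sum>i<N. K i j * w i))"
    by (simp add: sum_distrib_left)
  also have "\<dots> \<le> (\<Sum>j<M. (8 * (a j)\<^sup>2 / w j) * (8 * w j))"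
    using w by (intro sum_mono mult_left_mono col) (auto simp: less_imp_le)
  also have "\<dots> = (\<Sum>j<M. 64 * (a j)\<^sup>2)"
    using w by (intro sum.cong refl) (simp add: less_imp_neq[symmetric])
  finally show ?thesis by (simp add: K_def sum_distrib_left)
qed

lemma hilbert_row_summable:
  fixes x :: "nat \<Rightarrow> complex"
  assumes x: "summable (\<lambda>n. (norm (x n))\<^sup>2)"
  shows "summable (\<lambda>j. norm (x j / of_nat (i + j + 1)))"
proof (rule summableI_nonneg_bounded)
  fix M
  have "(\<Sum>j<M. norm (x j) / real (i + j + 1))\<^sup>2
      \<le> (\<Sum>k<Suc i. (\<Sum>j<M. norm (x j) / real (k + j + 1))\<^sup>2)"
    by (rule member_le_sum[of i "{..<Suc i}"]) auto
  also have "\<dots> \<le> 64 * (\<Sum>j<M. (norm (x j))\<^sup>2)"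
    by (rule hilbert_finite_bound) simp
  also have "\<dots> \<le> 64 * (\<Sum>j. (norm (x j))\<^sup>2)"
    using x by (simp add: sum_le_suminf)
  finally have "(\<Sum>j<M. norm (x j) / real (i + j + 1)) \<le> sqrt (64 * (\<Sum>j. (norm (x j))\<^sup>2))"
    by (rule real_le_rsqrt)
  then show "(\<Sum>j<M. norm (x j / of_nat (i + j + 1))) \<le> sqrt (64 * (\<Sum>j. (norm (x j))\<^sup>2))"
    by (simp add: norm_divide del: of_nat_add of_nat_Suc)
qed simp

lemma hilbert_partial_bound:
  fixes x :: "nat \<Rightarrow> complex"
  assumes x: "summable (\<lambda>n. (norm (x n))\<^sup>2)"
  shows "(\<Sum>i<N. (norm (\<Sum>j. x j / of_nat (i + j + 1)))\<^sup>2) \<le> 64 * (\<Sum>n. (norm (x n))\<^sup>2)"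
proof (rule LIMSEQ_le_const2)
  show "(\<lambda>M. \<Sum>i<N. (norm (\<Sum>j<M. x j / of_nat (i + j + 1)))\<^sup>2)
      \<longlonglongrightarrow> (\<Sum>i<N. (norm (\<Sum>j. x j / of_nat (i + j + 1)))\<^sup>2)"
    by (intro tendsto_sum tendsto_power tendsto_norm summable_LIMSEQ
        summable_norm_cancel[OF hilbert_row_summable[OF x]])
  have "(\<Sum>i<N. (norm (\<Sum>j<M. x j / of_nat (i + j + 1)))\<^sup>2) \<le> 64 * (\<Sum>n. (norm (x n))\<^sup>2)" for M
  proof -
    have "(\<Sum>i<N. (norm (\<Sum>j<M. x j / of_nat (i + j + 1)))\<^sup>2)
        \<le> (\<Sum>i<N. (\<Sum>j<M. norm (x j) / real (i + j + 1))\<^sup>2)"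
    proof (intro sum_mono power_mono norm_ge_zero)
      fix i
      have "norm (\<Sum>j<M. x j / of_nat (i + j + 1)) \<le> (\<Sum>j<M. norm (x j / of_nat (i + j + 1)))"
        by (rule norm_sum)
      then show "norm (\<Sum>j<M. x j / of_nat (i + j + 1)) \<le> (\<Sum>j<M. norm (x j) / real (i + j + 1))"
        by (simp add: norm_divide del: of_nat_add of_nat_Suc)
    qed
    also have "\<dots> \<le> 64 * (\<Sum>j<M. (norm (x j))\<^sup>2)"
      by (rule hilbert_finite_bound) simp
    also have "\<dots> \<le> 64 * (\<Sum>n. (norm (x n))\<^sup>2)"
      using x by (simp add: sum_le_suminf)
    finally show ?thesis .
  qed
  then show "\<exists>K. \<forall>M\<ge>K. (\<Sum>i<N. (norm (\<Sum>j<M. x j / of_nat (i + j + 1)))\<^sup>2)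
      \<le> 64 * (\<Sum>n. (norm (x n))\<^sup>2)"
    by blast
qed

lemma hilbert_square_summable:
  fixes x :: "nat \<Rightarrow> complex"
  assumes "summable (\<lambda>n. (norm (x n))\<^sup>2)"
  shows "summable (\<lambda>i. (norm (\<Sum>j. x j / of_nat (i + j + 1)))\<^sup>2)"
  by (rule summableI_nonneg_bounded[OF _ hilbert_partial_bound[OF assms]]) simp

lift_definition hilbert_matrix :: "ell2 \<Rightarrow> ell2"
  is "\<lambda>x i. \<Sum>j. x j / of_nat (i + j + 1)"
  by (rule hilbert_square_summable)

lemma norm_hilbert_matrix_le: "norm (hilbert_matrix x) \<le> 8 * norm x"
proof transfer
  fix x :: "nat \<Rightarrow> complex"
  assume x: "summable (\<lambda>n. (norm (x n))\<^sup>2)"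
  have "(\<Sum>i. (norm (\<Sum>j. x j / of_nat (i + j + 1)))\<^sup>2) \<le> 64 * (\<Sum>n. (norm (x n))\<^sup>2)"
    by (intro suminf_le_const hilbert_square_summable hilbert_partial_bound x)
  then have "sqrt (\<Sum>i. (norm (\<Sum>j. x j / of_nat (i + j + 1)))\<^sup>2)
      \<le> sqrt (8\<^sup>2 * (\<Sum>n. (norm (x n))\<^sup>2))"
    by (intro real_sqrt_le_mono) simp
  then show "sqrt (\<Sum>i. (norm (\<Sum>j. x j / of_nat (i + j + 1)))\<^sup>2)
      \<le> 8 * sqrt (\<Sum>n. (norm (x n))\<^sup>2)"
    by (simp only: real_sqrt_mult real_sqrt_abs abs_numeral)
qed

lemma bounded_clinear_hilbert_matrix: "bounded_clinear hilbert_matrix"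
  unfolding bounded_clinear_def
proof (intro conjI allI)
  show "bounded_linear hilbert_matrix"
  proof (rule bounded_linear_intro[where K = 8])
    fix x y :: ell2 and r :: real
    show "hilbert_matrix (x + y) = hilbert_matrix x + hilbert_matrix y"
      by transfer (auto simp only: fun_eq_iff add_divide_distrib
          intro!: suminf_add[symmetric] summable_norm_cancel[OF hilbert_row_summable])
    show "hilbert_matrix (r *\<^sub>R x) = r *\<^sub>R hilbert_matrix x"
      by transfer (auto simp only: fun_eq_iff scaleR_conv_of_real times_divide_eq_right[symmetric]
          intro!: suminf_mult summable_norm_cancel[OF hilbert_row_summable])
    show "norm (hilbert_matrix x) \<le> norm x * 8"
      using norm_hilbert_matrix_le[of x] by (simp add: mult.commute)
  qed
  fix c x
  show "hilbert_matrix (c *\<^sub>C x) = c *\<^sub>C hilbert_matrix x"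
    by transfer (auto simp only: fun_eq_iff times_divide_eq_right[symmetric]
        intro!: suminf_mult summable_norm_cancel[OF hilbert_row_summable])
qed

end

theory Submission
  imports Defs "HOL-Complex_Analysis.Cauchy_Integral_Theorem" "HOL-Real_Asymp.Real_Asymp"
begin

text \<open>
  The Hilbert matrix is unitarily equivalent to the multiplication operator by the
  \<open>symbol\<close> \<open>\<pi> / cosh (\<pi> t)\<close> on the even functions of \<open>L\<^sup>2(\<real>)\<close> with the \<open>weight\<close>
  \<open>\<pi> t sinh (\<pi> t) / (cosh (\<pi> t))\<^sup>2\<close>.  The unitary map sends the \<open>n\<close>-th basis vector to the continuous
  dual Hahn polynomial \<open>p\<^sub>n\<close> with all three parameters equal to \<open>1/2\<close>, here called \<open>hahn n\<close>.  The
  range of the symbol is \<open>(0, \<pi>]\<close>, and its closure is the spectrum; each value is taken at most twice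
  while the weight is a density, hence there are no eigenvalues.

  The model is found by a commutation argument: \<open>p\<^sub>n\<close> is the formal eigenvector of a tridiagonal
  (Jacobi) matrix which commutes with the Hilbert matrix.  A kernel \<open>B n m\<close> that commutes with
  this matrix is determined by its first row \<open>B 0 m\<close> (\<open>jacobi_commute_eqI\<close>).
  For \<open>i = 0, 1, 2\<close> the kernels \<open>\<integral> symbol\<^sup>i p\<^sub>n p\<^sub>m weight\<close> all commute with it, and they are therefore identified
  by their first rows as the identity, the Hilbert matrix and its square (\<open>gram_one\<close>,
  \<open>gram_symbol\<close>, \<open>gram_symbol_square\<close>).  The first rows for \<open>i = 0, 1\<close> reduce to moments, which
  satisfy a two-term recursion obtained by shifting a contour across a strip of width one
  (\<open>integral_strip_edges\<close>).  The case \<open>i = 2\<close> follows from Parseval's identity for the function \<open>symbol\<close> itself: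
  its squared norm is \<open>\<pi>\<^sup>2/6\<close>, which is also \<open>\<Sum> 1/(j+1)\<^sup>2\<close>.

  These three identities say that \<open>\<integral> |U + symbol V|\<^sup>2 weight\<close> equals the squared norm of \<open>u + H v\<close> for
  finitely supported sequences \<open>u\<close>, \<open>v\<close> with expansions \<open>U\<close>, \<open>V\<close> (\<open>isometry\<close>).  Every spectral
  question is decided by applying this identity to truncations:

  \<^item> If \<open>H x = l x\<close>, then the expansions of the truncations of \<open>x\<close> form a Cauchy sequence that concentrates
  on the null set where the symbol equals \<open>l\<close>, so \<open>x = 0\<close> (\<open>hilbert_matrix_no_eigenvector\<close>).

  \<^item> If \<open>l = symbol s\<close> with \<open>s > 0\<close>, then \<open>H x - l x = e\<^sub>0\<close> would make \<open>1 / (symbol - l)\<close>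
  square integrable near \<open>s\<close> (\<open>no_preimage_of_first_basis_vector\<close>); the end points \<open>0\<close> and \<open>\<pi>\<close>
  follow by perturbation (\<open>interval_subset_spectrum\<close>).

  \<^item> If \<open>l\<close> is outside \<open>[0, \<pi>]\<close>, then for a suitable \<open>a\<close> the function \<open>1 - a (symbol - l)\<close> is bounded by
  some \<open>q < 1\<close>, so \<open>1 - a (H - l)\<close> is a contraction and \<open>H - l\<close> is invertible (\<open>spectrum_subset_interval\<close>).
\<close>

section \<open>Integration over the real line\<close>

text \<open>
  The antiderivative enters through a symmetric limit, because for a primitive on a strip the values
  at the two ends are controlled only jointly, along the two short sides of a rectangle.
\<close>

lemma integral_real_line_FTC:
  fixes f F :: "real \<Rightarrow> 'a::euclidean_space"
  assumes int: "integrable lborel f" and cont: "continuous_on UNIV f"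
    and deriv: "\<And>t. (F has_vector_derivative f t) (at t)"
    and lim: "(\<lambda>n. F (real n) - F (- real n)) \<longlonglongrightarrow> L"
  shows "integral\<^sup>L lborel f = L"
proof (rule LIMSEQ_unique[OF _ lim])
  have "(\<lambda>n. \<integral>t. indicator {- real n..real n} t *\<^sub>R f t \<partial>lborel) \<longlonglongrightarrow> integral\<^sup>L lborel f"
  proof (rule integral_dominated_convergence[where w = "\<lambda>t. norm (f t)"])
    show "AE t in lborel. (\<lambda>n. indicator {- real n..real n} t *\<^sub>R f t) \<longlonglongrightarrow> f t"
    proof (rule AE_I2)
      fix t :: real
      obtain N where N: "\<bar>t\<bar> \<le> real N" using real_arch_simple by blast
      have "\<forall>\<^sub>F n in sequentially. indicator {- real n..real n} t *\<^sub>R f t = f t"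
        using eventually_ge_at_top[of N]
      proof eventually_elim
        case (elim n)
        then have "\<bar>t\<bar> \<le> real n" using N by linarith
        then show ?case by (auto simp: indicator_def)
      qed
      then show "(\<lambda>n. indicator {- real n..real n} t *\<^sub>R f t) \<longlonglongrightarrow> f t"
        by (rule tendsto_eventually)
    qed
    show "AE t in lborel. norm (indicator {- real n..real n} t *\<^sub>R f t) \<le> norm (f t)" for n
      by (rule AE_I2) (auto simp: indicator_def)
    show "(\<lambda>t. indicator {- real n..real n} t *\<^sub>R f t) \<in> borel_measurable lborel" for n
      using int by (intro borel_measurable_scaleR) auto
  qed (use int in auto)
  moreover have "(\<integral>t. indicator {- real n..real n} t *\<^sub>R f t \<partial>lborel) = F (real n) - F (- real n)" for n
    by (intro integral_FTC_atLeastAtMost)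
      (use deriv cont in \<open>auto intro: has_vector_derivative_at_within continuous_on_subset\<close>)
  ultimately show "(\<lambda>n. F (real n) - F (- real n)) \<longlonglongrightarrow> integral\<^sup>L lborel f" by simp
qed

lemma integrable_exp_minus_abs: "integrable lborel (\<lambda>t::real. exp (- \<bar>t\<bar>))"
proof -
  have "(\<lambda>t::real. exp (-1 * t)) absolutely_integrable_on {0..}"
    by (intro nonnegative_absolutely_integrable_1 integrable_on_exp_minus_to_infinity) auto
  then have "integrable (completion lborel) (\<lambda>t::real. indicator {0..} t *\<^sub>R exp (- t))"
    by (simp add: set_integrable_def)
  then have I: "integrable lborel (\<lambda>t::real. indicator {0..} t *\<^sub>R exp (- t))"
    by (subst (asm) integrable_completion) auto
  have J: "integrable lborel (\<lambda>t::real. indicator {0..} (- t) *\<^sub>R exp t)"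
    using lborel_integrable_real_affine[OF I, of "-1" 0] by simp
  show ?thesis
  proof (rule Bochner_Integration.integrable_bound[OF Bochner_Integration.integrable_add[OF I J]])
    show "AE t::real in lborel. norm (exp (- \<bar>t\<bar>)) \<le> norm (indicator {0..} t *\<^sub>R exp (- t)
        + indicator {0..} (- t) *\<^sub>R exp t)"
    proof (rule AE_I2)
      fix t :: real
      show "norm (exp (- \<bar>t\<bar>)) \<le> norm (indicator {0..} t *\<^sub>R exp (- t)
          + indicator {0..} (- t) *\<^sub>R exp t)"
        by (cases "t > 0"; cases "t < 0") (auto simp: indicator_def)
    qed
  qed auto
qed

text \<open>
  The class of functions whose integrals against the weight are manipulated: it is closed under
  sums and products, contains the polynomials and the symbol, and each member is
  dominated by the exponential decay of the weight.
\<close>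

definition subexp :: "(real \<Rightarrow> real) \<Rightarrow> bool" where
  "subexp f \<longleftrightarrow> continuous_on UNIV f \<and> (\<forall>e>0. \<exists>C. \<forall>t. \<bar>f t\<bar> \<le> C * exp (e * \<bar>t\<bar>))"

named_theorems subexp_intros

lemma subexpD:
  assumes "subexp f" "e > 0"
  obtains C where "C \<ge> 0" "\<And>t. \<bar>f t\<bar> \<le> C * exp (e * \<bar>t\<bar>)"
proof -
  from assms obtain C where C: "\<And>t. \<bar>f t\<bar> \<le> C * exp (e * \<bar>t\<bar>)"
    unfolding subexp_def by blast
  have "0 \<le> C" using C[of 0] by simp
  with C show ?thesis using that by blast
qed

lemma subexp_bounded:
  assumes "continuous_on UNIV f" "\<And>t. \<bar>f t\<bar> \<le> B"
  shows "subexp f"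
  unfolding subexp_def
proof (intro conjI allI impI exI)
  fix e t :: real assume "e > 0"
  have "B \<ge> 0" using assms(2)[of 0] by linarith
  then have "B * 1 \<le> B * exp (e * \<bar>t\<bar>)" using \<open>e > 0\<close> by (intro mult_left_mono) auto
  then show "\<bar>f t\<bar> \<le> B * exp (e * \<bar>t\<bar>)" using assms(2)[of t] by linarith
qed (rule assms)

lemma subexp_const [subexp_intros]: "subexp (\<lambda>_. c)"
  by (rule subexp_bounded[where B = "\<bar>c\<bar>"]) auto

lemma subexp_ident [subexp_intros]: "subexp (\<lambda>t. t)"
  unfolding subexp_def
proof (intro conjI allI impI exI)
  fix e t :: real assume e: "e > 0"
  have "e * \<bar>t\<bar> \<le> exp (e * \<bar>t\<bar>)" using exp_ge_add_one_self[of "e * \<bar>t\<bar>"] by linarith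
  then show "\<bar>t\<bar> \<le> (1 / e) * exp (e * \<bar>t\<bar>)" using e by (simp add: field_simps)
qed auto

lemma subexp_add [subexp_intros]:
  assumes "subexp f" "subexp g" shows "subexp (\<lambda>t. f t + g t)"
  unfolding subexp_def
proof (intro conjI allI impI)
  show "continuous_on UNIV (\<lambda>t. f t + g t)"
    using assms unfolding subexp_def by (auto intro: continuous_on_add)
  fix e :: real assume e: "e > 0"
  obtain C where C: "\<And>t. \<bar>f t\<bar> \<le> C * exp (e * \<bar>t\<bar>)" using subexpD[OF assms(1) e] by blast
  obtain D where D: "\<And>t. \<bar>g t\<bar> \<le> D * exp (e * \<bar>t\<bar>)" using subexpD[OF assms(2) e] by blast
  have "\<bar>f t + g t\<bar> \<le> (C + D) * exp (e * \<bar>t\<bar>)" for t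
    using C[of t] D[of t] abs_triangle_ineq[of "f t" "g t"] by (simp add: distrib_right)
  then show "\<exists>C. \<forall>t. \<bar>f t + g t\<bar> \<le> C * exp (e * \<bar>t\<bar>)" by blast
qed

lemma subexp_mult [subexp_intros]:
  assumes "subexp f" "subexp g" shows "subexp (\<lambda>t. f t * g t)"
  unfolding subexp_def
proof (intro conjI allI impI)
  show "continuous_on UNIV (\<lambda>t. f t * g t)"
    using assms unfolding subexp_def by (auto intro: continuous_on_mult)
  fix e :: real assume "e > 0"
  then have e: "e / 2 > 0" by simp
  obtain C where C: "C \<ge> 0" "\<And>t. \<bar>f t\<bar> \<le> C * exp (e / 2 * \<bar>t\<bar>)"
    using subexpD[OF assms(1) e] by blast
  obtain D where D: "\<And>t. \<bar>g t\<bar> \<le> D * exp (e / 2 * \<bar>t\<bar>)" using subexpD[OF assms(2) e] by blast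
  have "\<bar>f t * g t\<bar> \<le> (C * D) * exp (e * \<bar>t\<bar>)" for t
  proof -
    have "\<bar>f t * g t\<bar> \<le> (C * exp (e / 2 * \<bar>t\<bar>)) * (D * exp (e / 2 * \<bar>t\<bar>))"
      unfolding abs_mult using C D by (intro mult_mono) auto
    also have "\<dots> = C * D * (exp (e / 2 * \<bar>t\<bar>) * exp (e / 2 * \<bar>t\<bar>))" by (simp add: mult_ac)
    also have "exp (e / 2 * \<bar>t\<bar>) * exp (e / 2 * \<bar>t\<bar>) = exp (e * \<bar>t\<bar>)"
      by (simp add: exp_add[symmetric])
    finally show ?thesis .
  qed
  then show "\<exists>C. \<forall>t. \<bar>f t * g t\<bar> \<le> C * exp (e * \<bar>t\<bar>)" by blast
qed

lemma subexp_uminus [subexp_intros]: "subexp f \<Longrightarrow> subexp (\<lambda>t. - f t)"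
  using subexp_mult[OF subexp_const[of "-1"], of f] by simp

lemma subexp_diff [subexp_intros]: "subexp f \<Longrightarrow> subexp g \<Longrightarrow> subexp (\<lambda>t. f t - g t)"
  using subexp_add[OF _ subexp_uminus, of f g] by simp

lemma subexp_divide_const [subexp_intros]: "subexp f \<Longrightarrow> subexp (\<lambda>t. f t / c)"
  using subexp_mult[OF subexp_const[of "inverse c"], of f] by (simp add: divide_inverse mult.commute)

lemma subexp_power [subexp_intros]: "subexp f \<Longrightarrow> subexp (\<lambda>t. f t ^ n)"
  by (induction n) (auto intro!: subexp_intros)

lemma subexp_sum [subexp_intros]:
  "(\<And>i. i \<in> A \<Longrightarrow> subexp (f i)) \<Longrightarrow> subexp (\<lambda>t. \<Sum>i\<in>A. f i t)"
  by (induction A rule: infinite_finite_induct) (auto intro!: subexp_intros)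

lemma subexp_prod [subexp_intros]:
  "(\<And>i. i \<in> A \<Longrightarrow> subexp (f i)) \<Longrightarrow> subexp (\<lambda>t. \<Prod>i\<in>A. f i t)"
  by (induction A rule: infinite_finite_induct) (auto intro!: subexp_intros)

section \<open>The spectral model\<close>

definition weight :: "real \<Rightarrow> real" where
  "weight t = pi * t * sinh (pi * t) / (cosh (pi * t))\<^sup>2"

definition symbol :: "real \<Rightarrow> real" where
  "symbol t = pi / cosh (pi * t)"

text \<open>
  This is \<open>|(1/2 + i t)\<^sub>k|\<^sup>2\<close>, the squared modulus of a Pochhammer symbol.
\<close>

definition qprod :: "nat \<Rightarrow> real \<Rightarrow> real" where
  "qprod k t = (\<Prod>l<k. (real l + 1/2)\<^sup>2 + t\<^sup>2)"

text \<open>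
  The hypergeometric sum \<open>\<^sub>3F\<^sub>2(-n, 1/2 + i t, 1/2 - i t; 1, 1; 1)\<close>, which is the normalised continuous dual Hahn
  polynomial with parameters \<open>(1/2, 1/2, 1/2)\<close>.
\<close>

definition hahn :: "nat \<Rightarrow> real \<Rightarrow> real" where
  "hahn n t = (\<Sum>k\<le>n. (-1) ^ k * real (n choose k) * (qprod k t / (fact k)\<^sup>2))"

lemma mult_sinh_nonneg: "0 \<le> t * sinh (pi * t)"
  by (cases "t \<ge> 0") (auto simp: zero_le_mult_iff mult_le_0_iff)

lemma weight_nonneg: "weight t \<ge> 0"
  unfolding weight_def using mult_sinh_nonneg[of t] by (simp add: mult.assoc)

lemma symbol_pos: "symbol t > 0"
  by (simp add: symbol_def)

lemma symbol_le: "symbol t \<le> pi"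
  using cosh_real_ge_1[of "pi * t"] by (simp add: symbol_def divide_le_eq mult_le_cancel_left1)

lemma continuous_on_weight [continuous_intros]: "continuous_on A weight"
  unfolding weight_def by (intro continuous_intros) auto

lemma continuous_on_symbol [continuous_intros]: "continuous_on A symbol"
  unfolding symbol_def by (intro continuous_intros) auto

lemma subexp_symbol [subexp_intros]: "subexp symbol"
proof (rule subexp_bounded[where B = pi])
  show "\<bar>symbol t\<bar> \<le> pi" for t using symbol_pos[of t] symbol_le[of t] by simp
qed (intro continuous_intros)

lemma subexp_qprod [subexp_intros]: "subexp (qprod k)"
  unfolding qprod_def[abs_def] by (intro subexp_intros)

lemma subexp_hahn [subexp_intros]: "subexp (hahn k)"
  unfolding hahn_def[abs_def] by (intro subexp_intros)

text \<open>
  The rate \<open>3 < \<pi>\<close> absorbs the growth of a subexponential factor and leaves an integrable bound.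
\<close>

lemma inverse_cosh_le: "1 / cosh (pi * t) \<le> 2 * exp (- (3 * \<bar>t\<bar>))"
proof -
  have "cosh (pi * t) = cosh (pi * \<bar>t\<bar>)"
    by (metis abs_mult abs_of_pos cosh_real_abs pi_gt_zero)
  also have "\<dots> \<ge> exp (pi * \<bar>t\<bar>) / 2" by (simp add: cosh_field_def)
  finally have *: "exp (pi * \<bar>t\<bar>) / 2 \<le> cosh (pi * t)" .
  have "exp (3 * \<bar>t\<bar>) \<le> exp (pi * \<bar>t\<bar>)" using pi_gt3 by (simp add: mult_right_mono)
  with * have "exp (3 * \<bar>t\<bar>) / 2 \<le> cosh (pi * t)" by linarith
  then have "1 / cosh (pi * t) \<le> 1 / (exp (3 * \<bar>t\<bar>) / 2)"
    by (intro divide_left_mono) auto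
  then show ?thesis by (simp add: exp_minus field_simps)
qed

lemma integrable_subexp_sinh_cosh:
  assumes "subexp f"
  shows "integrable lborel (\<lambda>t. f t * (sinh (pi * t) / (cosh (pi * t))\<^sup>2))"
proof -
  obtain C where C: "C \<ge> 0" "\<And>t. \<bar>f t\<bar> \<le> C * exp (1 * \<bar>t\<bar>)"
    using subexpD[OF assms, of 1] by auto
  show ?thesis
  proof (rule Bochner_Integration.integrable_bound)
    show "integrable lborel (\<lambda>t. 2 * C * exp (- \<bar>t\<bar>))"
      using integrable_exp_minus_abs by (intro integrable_mult_right) auto
    have "continuous_on UNIV f" using assms by (simp add: subexp_def)
    then show "(\<lambda>t. f t * (sinh (pi * t) / (cosh (pi * t))\<^sup>2)) \<in> borel_measurable lborel"
      by (auto intro!: borel_measurable_continuous_onI continuous_intros)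
    show "AE t in lborel. norm (f t * (sinh (pi * t) / (cosh (pi * t))\<^sup>2))
        \<le> norm (2 * C * exp (- \<bar>t\<bar>))"
    proof (rule AE_I2)
      fix t
      have "\<bar>sinh (pi * t)\<bar> \<le> cosh (pi * t)"
        using sinh_le_cosh_real[of "pi * t"] sinh_le_cosh_real[of "- (pi * t)"]
        by (simp add: abs_le_iff)
      then have "\<bar>sinh (pi * t)\<bar> / (cosh (pi * t))\<^sup>2 \<le> cosh (pi * t) / (cosh (pi * t))\<^sup>2"
        by (intro divide_right_mono) auto
      also have "\<dots> = 1 / cosh (pi * t)" by (simp add: power2_eq_square)
      also have "\<dots> \<le> 2 * exp (- (3 * \<bar>t\<bar>))" by (rule inverse_cosh_le)
      finally have "\<bar>f t\<bar> * (\<bar>sinh (pi * t)\<bar> / (cosh (pi * t))\<^sup>2)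
          \<le> (C * exp (1 * \<bar>t\<bar>)) * (2 * exp (- (3 * \<bar>t\<bar>)))"
        using C by (intro mult_mono) auto
      also have "\<dots> = 2 * C * exp (- \<bar>t\<bar> - \<bar>t\<bar>)"
        by (simp add: exp_add[symmetric])
      also have "\<dots> \<le> 2 * C * exp (- \<bar>t\<bar>)" using C by (intro mult_left_mono) auto
      finally show "norm (f t * (sinh (pi * t) / (cosh (pi * t))\<^sup>2)) \<le> norm (2 * C * exp (- \<bar>t\<bar>))"
        using C by (simp add: abs_mult)
    qed
  qed
qed

lemma integrable_subexp_weight:
  assumes "subexp f"
  shows "integrable lborel (\<lambda>t. f t * weight t)"
proof -
  have "integrable lborel (\<lambda>t. (f t * (pi * t)) * (sinh (pi * t) / (cosh (pi * t))\<^sup>2))"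
    using assms by (intro integrable_subexp_sinh_cosh subexp_intros)
  then show ?thesis by (simp add: weight_def mult_ac)
qed

section \<open>Shifting the contour across a strip\<close>

lemma norm_sinh_ge: "\<bar>sinh (Re z)\<bar> \<le> norm (sinh z)" for z :: complex
proof -
  have "\<bar>norm (exp z) - norm (exp (- z))\<bar> \<le> norm (exp z - exp (- z))"
    by (rule norm_triangle_ineq3)
  then show ?thesis by (simp add: sinh_field_def norm_divide abs_divide)
qed

lemma norm_cosh_le: "norm (cosh z) \<le> cosh (Re z)" for z :: complex
proof -
  have "norm (exp z + exp (- z)) \<le> norm (exp z) + norm (exp (- z))"
    by (rule norm_triangle_ineq)
  then show ?thesis by (simp add: cosh_field_def norm_divide)
qed

definition strip :: "complex set" where
  "strip = {z. \<bar>Im z\<bar> \<le> 1/2}"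

lemma strip_eq_halfplanes: "strip = {z. Im z \<le> 1/2} \<inter> {z. Im z \<ge> - 1/2}"
  by (auto simp: strip_def)

lemma convex_strip: "convex strip"
  unfolding strip_eq_halfplanes by (intro convex_Int convex_halfspace_Im_le convex_halfspace_Im_ge)

text \<open>
  Cauchy's theorem for the strip.  A primitive \<open>G\<close> of \<open>g\<close> exists by convexity, and the integral
  of \<open>f\<close> over \<open>[-n, n]\<close> is a difference of values of \<open>G\<close> across the two short sides, where \<open>g\<close> is
  exponentially small.  The exceptional point \<open>0\<close> is a removable singularity in the application.
\<close>

lemma integral_strip_edges:
  assumes cont: "continuous_on strip g"
    and diff: "\<And>z. z \<in> interior strip - {0} \<Longrightarrow> g field_differentiable at z"
    and decay: "\<And>z. z \<in> strip \<Longrightarrow> \<bar>Re z\<bar> \<ge> 1 \<Longrightarrow> norm (g z) \<le> C * exp (- \<bar>Re z\<bar>)"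
    and f: "\<And>t. f t = g (Complex t (- 1/2)) - g (Complex t (1/2))"
    and int: "integrable lborel f"
  shows "integral\<^sup>L lborel f = 0"
proof -
  obtain G where G: "\<And>z. z \<in> strip \<Longrightarrow> (G has_field_derivative g z) (at z within strip)"
    using holomorphic_convex_primitive[of strip "{0}" g, OF convex_strip _ cont diff] by blast
  have edge: "((\<lambda>t. G (Complex t y)) has_vector_derivative g (Complex t y)) (at t)"
    if "\<bar>y\<bar> \<le> 1/2" for t y
  proof -
    have "((\<lambda>t. Complex t y) has_vector_derivative 1) (at t)"
      unfolding Complex_eq by (auto intro!: derivative_eq_intros)
    moreover have "(G has_field_derivative g (Complex t y)) (at (Complex t y) within range (\<lambda>t. Complex t y))"
      using that by (intro has_field_derivative_subset[OF G]) (auto simp: strip_def)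
    ultimately have "((G \<circ> (\<lambda>t. Complex t y)) has_vector_derivative 1 * g (Complex t y)) (at t)"
      by (rule field_vector_diff_chain_within)
    then show ?thesis by (simp add: o_def)
  qed
  show ?thesis
  proof (rule integral_real_line_FTC[where
      F = "\<lambda>t. G (Complex t (- 1/2)) - G (Complex t (1/2))"])
    show "integrable lborel f" by fact
    have "continuous_on UNIV (\<lambda>t. g (Complex t y))" if "\<bar>y\<bar> \<le> 1/2" for y
      using that by (intro continuous_on_compose2[OF cont])
        (auto simp: strip_def Complex_eq intro!: continuous_intros)
    from this[of "-1/2"] this[of "1/2"] show "continuous_on UNIV f"
      unfolding f[abs_def] by (intro continuous_on_diff) auto
    show "((\<lambda>t. G (Complex t (- 1/2)) - G (Complex t (1/2))) has_vector_derivative f t) (at t)" for t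
      unfolding f by (intro derivative_intros edge) auto
    have bound: "norm (G (Complex t (- 1/2)) - G (Complex t (1/2))) \<le> C * exp (- \<bar>t\<bar>)"
      if t: "\<bar>t\<bar> \<ge> 1" for t
    proof -
      define S where "S = strip \<inter> {z. Re z = t}"
      have "norm (G (Complex t (- 1/2)) - G (Complex t (1/2)))
          \<le> C * exp (- \<bar>t\<bar>) * norm (Complex t (- 1/2) - Complex t (1/2))"
      proof (rule field_differentiable_bound)
        show "convex S" unfolding S_def
          using convex_hyperplane[of "1::complex" t] by (intro convex_Int convex_strip) simp
        show "(G has_field_derivative g z) (at z within S)" if "z \<in> S" for z
          using G[of z] that unfolding S_def by (auto intro: has_field_derivative_subset)
        show "norm (g z) \<le> C * exp (- \<bar>t\<bar>)" if "z \<in> S" for z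
          using decay[of z] that t unfolding S_def by auto
      qed (auto simp: S_def strip_def)
      also have "Complex t (- 1/2) - Complex t (1/2) = - \<i>"
        by (simp add: complex_eq_iff)
      finally show ?thesis by simp
    qed
    show "(\<lambda>n. G (Complex (real n) (- 1/2)) - G (Complex (real n) (1/2))
        - (G (Complex (- real n) (- 1/2)) - G (Complex (- real n) (1/2)))) \<longlonglongrightarrow> 0"
    proof (rule Lim_null_comparison)
      show "\<forall>\<^sub>F n in sequentially. norm (G (Complex (real n) (- 1/2)) - G (Complex (real n) (1/2))
        - (G (Complex (- real n) (- 1/2)) - G (Complex (- real n) (1/2)))) \<le> 2 * C * exp (- real n)"
        using eventually_ge_at_top[of 1]
      proof eventually_elim
        case (elim n)
        then show ?case
          using bound[of "real n"] bound[of "- real n"]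
          by (intro order_trans[OF norm_triangle_ineq4]) simp
      qed
      show "(\<lambda>n. 2 * C * exp (- real n)) \<longlonglongrightarrow> 0"
        by real_asymp
    qed
  qed
qed

text \<open>
  The product \<open>qprod\<close> with its factors moved by half a unit, which makes it symmetric about the
  centre line of the strip.  On either edge it becomes a linear factor times \<open>qprod\<close>
  (\<open>shifted_prod_edge\<close>).
\<close>

definition shifted_prod :: "nat \<Rightarrow> complex \<Rightarrow> complex" where
  "shifted_prod k z = (\<Prod>l<k. (of_nat l + 1)\<^sup>2 + z\<^sup>2)"

definition sinh_quot :: "complex \<Rightarrow> complex" where
  "sinh_quot z = (if z = 0 then 1 / of_real pi else z / sinh (of_real pi * z))"

lemma sinh_strip_nonzero:
  assumes "z \<in> strip" "z \<noteq> 0" shows "sinh (of_real pi * z) \<noteq> 0"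
proof
  assume *: "sinh (of_real pi * z) = 0"
  then have "\<bar>sinh (pi * Re z)\<bar> \<le> 0" using norm_sinh_ge[of "of_real pi * z"] by simp
  then have re: "Re z = 0" by simp
  have "exp (of_real pi * z) = exp (- (of_real pi * z))"
    using * by (simp add: sinh_field_def)
  then have "Im (exp (of_real pi * z)) = Im (exp (- (of_real pi * z)))" by simp
  then have "sin (pi * Im z) = 0" using re by (simp add: Im_exp)
  moreover have "\<bar>pi * Im z\<bar> < pi"
    using assms by (simp add: strip_def abs_mult)
  ultimately have "pi * Im z = 0" by (metis sin_eq_0_pi abs_less_iff minus_less_iff)
  with re assms show False by (simp add: complex_eq_iff)
qed

lemma continuous_on_sinh_quot: "continuous_on strip sinh_quot"
proof (rule continuous_at_imp_continuous_on, safe)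
  fix z assume z: "z \<in> strip"
  show "isCont sinh_quot z"
  proof (cases "z = 0")
    case True
    have "((\<lambda>w. sinh (of_real pi * w)) has_field_derivative of_real pi) (at (0::complex))"
      by (auto intro!: derivative_eq_intros)
    then have "((\<lambda>w. sinh (of_real pi * w) / w) \<longlongrightarrow> of_real pi) (at (0::complex))"
      by (simp add: has_field_derivative_iff)
    then have "((\<lambda>w. 1 / (sinh (of_real pi * w) / w)) \<longlongrightarrow> 1 / of_real pi) (at (0::complex))"
      by (intro tendsto_divide) auto
    then have "(sinh_quot \<longlongrightarrow> 1 / of_real pi) (at 0)"
      by (rule Lim_transform_eventually) (auto simp: sinh_quot_def eventually_at_filter)
    then show ?thesis using True by (simp add: isCont_def sinh_quot_def)
  next
    case False
    have "isCont (\<lambda>z. z / sinh (of_real pi * z)) z"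
      using sinh_strip_nonzero[OF z False] by (intro continuous_intros) auto
    moreover have "\<forall>\<^sub>F w in nhds z. sinh_quot w = w / sinh (of_real pi * w)"
      using t1_space_nhds[OF False] by eventually_elim (simp add: sinh_quot_def)
    ultimately show ?thesis by (simp add: isCont_cong)
  qed
qed

lemma field_differentiable_sinh_quot:
  assumes "z \<in> strip" "z \<noteq> 0" shows "sinh_quot field_differentiable at z"
proof -
  obtain D where D: "((\<lambda>z. z / sinh (of_real pi * z)) has_field_derivative D) (at z)"
    using sinh_strip_nonzero[OF assms] by (auto intro!: that derivative_eq_intros)
  have ev: "\<forall>\<^sub>F w in nhds z. sinh_quot w = w / sinh (of_real pi * w)"
    using t1_space_nhds[OF assms(2)] by eventually_elim (simp add: sinh_quot_def)
  have "(sinh_quot has_field_derivative D) (at z)"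
    using D by (subst DERIV_cong_ev[OF refl ev refl])
  then show ?thesis by (auto simp: field_differentiable_def)
qed

lemma power_le_fact_exp: "y ^ n \<le> fact n * exp y" if "y \<ge> 0" for y :: real
proof -
  have "(\<Sum>i\<in>{n}. y ^ i / fact i) \<le> (\<Sum>i. y ^ i / fact i)"
    using that summable_exp[of y] by (intro sum_le_suminf) (auto simp: divide_inverse mult.commute)
  also have "\<dots> = exp y"
    using exp_converges[of y] by (simp add: sums_iff divide_inverse mult.commute)
  finally show ?thesis by (simp add: divide_le_eq mult.commute)
qed

lemma norm_power_shifted_prod_le: "\<exists>C\<ge>0. \<forall>z\<in>strip. norm (z ^ j * shifted_prod k z) \<le> C * exp \<bar>Re z\<bar>"
proof -
  have "norm (z ^ j * shifted_prod k z) \<le> fact (j + 2 * k) * exp (real k + 1) * exp \<bar>Re z\<bar>" if z: "z \<in> strip" for z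
  proof -
    define y where "y = real k + norm z"
    have y: "y \<ge> 0" by (simp add: y_def)
    have "norm (shifted_prod k z) \<le> (\<Prod>l<k. y\<^sup>2)"
      unfolding shifted_prod_def prod_norm[symmetric]
    proof (intro prod_mono conjI norm_ge_zero)
      fix l assume "l \<in> {..<k}"
      have "norm (of_nat l + 1 :: complex) = real l + 1"
        by (metis norm_of_nat of_nat_Suc add.commute)
      then have "norm ((of_nat l + 1)\<^sup>2 + z\<^sup>2) \<le> (real l + 1)\<^sup>2 + (norm z)\<^sup>2"
        using norm_triangle_ineq[of "(of_nat l + 1)\<^sup>2" "z\<^sup>2"] by (simp add: norm_power)
      also have "\<dots> \<le> (real l + 1 + norm z)\<^sup>2" by (simp add: power2_sum)
      also have "\<dots> \<le> y\<^sup>2" using \<open>l \<in> {..<k}\<close> by (intro power_mono) (auto simp: y_def)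
      finally show "norm ((of_nat l + 1)\<^sup>2 + z\<^sup>2) \<le> y\<^sup>2" .
    qed
    then have "norm (z ^ j * shifted_prod k z) \<le> y ^ j * y ^ (2 * k)"
      unfolding norm_mult norm_power using y
      by (intro mult_mono power_mono) (auto simp: y_def power_mult)
    also have "\<dots> = y ^ (j + 2 * k)" by (simp add: power_add)
    also have "\<dots> \<le> fact (j + 2 * k) * exp y"
      using y by (rule power_le_fact_exp)
    also have "exp y \<le> exp (real k + 1 + \<bar>Re z\<bar>)"
      using z cmod_le[of z] by (auto simp: y_def strip_def)
    also have "\<dots> = exp (real k + 1) * exp \<bar>Re z\<bar>" by (simp add: exp_add)
    finally show ?thesis by (simp add: mult.assoc)
  qed
  then show ?thesis by (intro exI[of _ "fact (j + 2 * k) * exp (real k + 1)"]) auto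
qed

lemma sinh_cosh_edge:
  assumes "s\<^sup>2 = 1"
  shows "sinh (of_real pi * Complex t (s / 2)) = \<i> * of_real (s * cosh (pi * t))" (is ?A)
    and "cosh (of_real pi * Complex t (s / 2)) = \<i> * of_real (s * sinh (pi * t))" (is ?B)
proof -
  from assms have "s = 1 \<or> s = - 1" by (simp add: power2_eq_1_iff)
  then show ?A ?B
    by (auto simp: complex_eq_iff sinh_field_def cosh_field_def Re_exp Im_exp sin_minus cos_minus)
qed

section \<open>Moments of the weight\<close>

text \<open>
  Multiplication by \<open>z\<close> completes one of the two Pochhammer symbols: the factors \<open>(l + 1 - i z)(l + 1 + i z)\<close>
  on the edge are those of \<open>qprod\<close>, one of the two sequences being shifted by one.
\<close>

lemma shifted_prod_edge:
  fixes s t :: real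
  assumes s: "s\<^sup>2 = 1"
  defines "z \<equiv> Complex t (s / 2)"
  shows "z * shifted_prod k z = \<i> * of_real s * (of_real (real k + 1/2) - \<i> * of_real (s * t)) * of_real (qprod k t)"
proof -
  have z: "z = of_real t + \<i> * of_real s / 2"
    by (simp add: z_def complex_eq_iff)
  have s2: "(of_real s :: complex)\<^sup>2 = 1"
    using s by (metis of_real_1 of_real_power)
  show ?thesis
  proof (induction k)
    case 0
    show ?case using s2 by (simp add: shifted_prod_def qprod_def z algebra_simps power2_eq_square)
  next
    case (Suc k)
    define a b c :: complex where "a = of_real (real k)" and "b = of_real t" and "c = of_real s"
    have c: "c * c = 1" using s2 by (simp add: c_def power2_eq_square)
    define w where "w = \<i> * (c * b)"
    have "w * w = (\<i> * \<i>) * (c * c) * (b * b)" by (simp only: w_def mult_ac)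
    then have bw: "b * b = - (w * w)" using c by simp
    have "(b + \<i> * c / 2)\<^sup>2 = b * b + w + (\<i> * \<i>) * (c * c) / 4"
      by (simp add: w_def power2_eq_square field_simps)
    then have sq: "(b + \<i> * c / 2)\<^sup>2 = w - w * w - 1/4" using c bw by simp
    have key: "(a + 1/2 - \<i> * (c * b)) * ((a + 1)\<^sup>2 + (b + \<i> * c / 2)\<^sup>2)
        = (a + 1 + 1/2 - \<i> * (c * b)) * ((a + 1/2)\<^sup>2 + b\<^sup>2)"
      unfolding sq power2_eq_square[of b] bw w_def[symmetric] by (simp add: power2_eq_square field_simps)
    have "z * shifted_prod (Suc k) z = (z * shifted_prod k z) * ((a + 1)\<^sup>2 + (b + \<i> * c / 2)\<^sup>2)"
      by (simp add: shifted_prod_def a_def b_def c_def z)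
    also have "\<dots> = \<i> * c * ((a + 1/2 - \<i> * (c * b)) * ((a + 1)\<^sup>2 + (b + \<i> * c / 2)\<^sup>2)) * of_real (qprod k t)"
      unfolding Suc.IH by (simp add: a_def b_def c_def)
    also have "\<dots> = \<i> * c * (a + 1 + 1/2 - \<i> * (c * b)) * of_real (qprod (Suc k) t)"
      unfolding key by (simp add: qprod_def a_def b_def c_def)
    finally show ?case by (simp add: a_def b_def c_def)
  qed
qed

text \<open>
  For \<open>m = 2\<close> the difference of the edge values is a polynomial times the weight, for \<open>m = 3\<close> a polynomial times
  the weight and the symbol.  The factor \<open>z\<^sup>m\<close> inside \<open>sinh_quot\<^sup>m\<close> cancels the pole of \<open>cosh / sinh\<^sup>m\<close> at
  the centre, and the factor \<open>z\<close> is what turns \<open>shifted_prod\<close> into \<open>qprod\<close> on the edges.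
\<close>

definition strip_fun :: "nat \<Rightarrow> nat \<Rightarrow> complex \<Rightarrow> complex" where
  "strip_fun m k z = z * shifted_prod k z * cosh (of_real pi * z) * sinh_quot z ^ m"

lemma strip_fun_edge:
  fixes s t :: real
  assumes s: "s\<^sup>2 = 1"
  defines "z \<equiv> Complex t (s / 2)"
  shows "strip_fun m k z = - ((of_real (real k + 1/2) - \<i> * of_real (s * t)) * z ^ m * (- \<i> * of_real s) ^ m
    * of_real (qprod k t * sinh (pi * t) / cosh (pi * t) ^ m))"
proof -
  have s2: "(of_real s :: complex) * of_real s = 1"
    using s by (metis of_real_1 of_real_mult power2_eq_square)
  then have s3: "inverse (of_real s :: complex) = of_real s" by (metis inverse_unique)
  have "s \<noteq> 0" using s by auto
  then have "z \<noteq> 0" by (simp add: z_def complex_eq_iff)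
  then have "sinh_quot z = z / (\<i> * of_real (s * cosh (pi * t)))"
    unfolding sinh_quot_def z_def using sinh_cosh_edge[OF s] by simp
  also have "\<dots> = z * (- \<i> * of_real s) / of_real (cosh (pi * t))"
    by (simp add: divide_inverse s3)
  finally have sinh_quot: "sinh_quot z ^ m = z ^ m * (- \<i> * of_real s) ^ m / of_real (cosh (pi * t) ^ m)"
    by (simp only: power_mult_distrib power_divide of_real_power)
  have "strip_fun m k z = (\<i> * \<i>) * (of_real s * of_real s) * (of_real (real k + 1/2) - \<i> * of_real (s * t))
      * of_real (qprod k t) * of_real (sinh (pi * t)) * sinh_quot z ^ m"
    unfolding strip_fun_def z_def shifted_prod_edge[OF s] sinh_cosh_edge[OF s] by (simp only: of_real_mult mult_ac)
  moreover define A :: complex where "A = of_real (real k + 1/2) - \<i> * of_real (s * t)"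
  ultimately show ?thesis unfolding s2 sinh_quot A_def[symmetric] by (simp add: mult_ac)
qed

lemma continuous_on_strip_fun: "continuous_on strip (strip_fun m k)"
  unfolding strip_fun_def[abs_def] shifted_prod_def by (intro continuous_intros continuous_on_sinh_quot)

lemma field_differentiable_strip_fun:
  assumes "z \<in> strip" "z \<noteq> 0" shows "strip_fun m k field_differentiable at z"
proof -
  have "(\<lambda>z. z * shifted_prod k z * cosh (of_real pi * z)) field_differentiable at z"
    unfolding shifted_prod_def cosh_field_def by (intro holomorphic_on_imp_differentiable_at[of _ UNIV] holomorphic_intros) auto
  then show ?thesis
    unfolding strip_fun_def[abs_def]
    by (rule field_differentiable_mult[OF _ field_differentiable_power[OF field_differentiable_sinh_quot[OF assms]]])
qed

text \<open>
  Away from the pole \<open>|sinh|\<close> and \<open>cosh\<close> are comparable, so that \<open>m \<ge> 2\<close> leaves at least one factor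
  \<open>1 / cosh\<close> to beat the polynomial growth.
\<close>

lemma norm_strip_fun_le:
  assumes m: "m \<ge> 2"
  shows "\<exists>C. \<forall>z\<in>strip. \<bar>Re z\<bar> \<ge> 1 \<longrightarrow> norm (strip_fun m k z) \<le> C * exp (- \<bar>Re z\<bar>)"
proof -
  obtain C where C: "C \<ge> 0" "\<And>z. z \<in> strip \<Longrightarrow> norm (z ^ Suc m * shifted_prod k z) \<le> C * exp \<bar>Re z\<bar>"
    using norm_power_shifted_prod_le[of "Suc m" k] by blast
  have "norm (strip_fun m k z) \<le> (C * 2 ^ Suc m) * exp (- \<bar>Re z\<bar>)" if z: "z \<in> strip" "\<bar>Re z\<bar> \<ge> 1" for z
  proof -
    define c where "c = cosh (pi * Re z)"
    have c1: "c \<ge> 1" unfolding c_def by (rule cosh_real_ge_1)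
    have half: "c / 2 \<le> \<bar>sinh (pi * Re z)\<bar>"
    proof -
      define y where "y = pi * \<bar>Re z\<bar>"
      have "y \<ge> 1 * 1" unfolding y_def using z pi_gt3 by (intro mult_mono) auto
      then have y: "y \<ge> 1" by simp
      have "3 \<le> 1 + y + y" using y by simp
      also have "\<dots> \<le> exp (y + y)" using exp_ge_add_one_self[of "y + y"] by linarith
      finally have "3 * exp (- y) \<le> exp (y + y) * exp (- y)" by (intro mult_right_mono) auto
      also have "\<dots> = exp y" by (simp add: exp_add[symmetric])
      finally have "cosh y / 2 \<le> sinh y" by (simp add: cosh_field_def sinh_field_def)
      moreover have "cosh y = c" unfolding c_def y_def
        by (metis abs_mult abs_of_pos cosh_real_abs pi_gt_zero)
      moreover have "sinh y = \<bar>sinh (pi * Re z)\<bar>" unfolding y_def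
        by (metis abs_mult abs_of_pos sinh_real_abs pi_gt_zero)
      ultimately show ?thesis by simp
    qed
    have "z \<noteq> 0" using z by auto
    have "norm (sinh (of_real pi * z)) \<ge> c / 2"
      using half norm_sinh_ge[of "of_real pi * z"] by simp
    then have sinh_quot: "norm (sinh_quot z) \<le> 2 * norm z / c"
      using \<open>z \<noteq> 0\<close> c1 by (simp add: sinh_quot_def norm_divide) (simp add: divide_simps mult_left_mono)
    have cosh: "norm (cosh (of_real pi * z)) \<le> c"
      using norm_cosh_le[of "of_real pi * z"] by (simp add: c_def)
    have "norm (strip_fun m k z) = norm (z * shifted_prod k z) * norm (cosh (of_real pi * z)) * norm (sinh_quot z) ^ m"
      by (simp add: strip_fun_def norm_mult norm_power)
    also have "\<dots> \<le> norm (z * shifted_prod k z) * c * (2 * norm z / c) ^ m"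
      using sinh_quot cosh c1 by (intro mult_mono power_mono) auto
    also have "\<dots> = norm (z ^ Suc m * shifted_prod k z) * 2 ^ m * (c / c ^ m)"
      by (simp add: norm_mult norm_power power_divide power_mult_distrib mult_ac)
    also have "\<dots> \<le> (C * exp \<bar>Re z\<bar>) * 2 ^ m * (2 * exp (- (3 * \<bar>Re z\<bar>)))"
    proof (intro mult_mono C z)
      obtain j where m: "m = 2 + j" using m le_Suc_ex by blast
      have "c / c ^ m = (1 / c) * (1 / c ^ j)" using c1 by (simp add: m power_add power2_eq_square)
      also have "\<dots> \<le> (1 / c) * 1" using c1 by (intro mult_left_mono) auto
      also have "\<dots> \<le> 2 * exp (- (3 * \<bar>Re z\<bar>))"
        unfolding c_def using inverse_cosh_le[of "Re z"] by simp
      finally show "c / c ^ m \<le> 2 * exp (- (3 * \<bar>Re z\<bar>))" .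
    qed (use C c1 in auto)
    also have "\<dots> = (C * 2 ^ Suc m) * exp (\<bar>Re z\<bar> - 3 * \<bar>Re z\<bar>)"
    proof -
      have "exp (\<bar>Re z\<bar> - 3 * \<bar>Re z\<bar>) = exp \<bar>Re z\<bar> * exp (- (3 * \<bar>Re z\<bar>))"
        by (simp add: exp_add[symmetric])
      then show ?thesis by (simp only: power_Suc mult_ac)
    qed
    also have "\<dots> \<le> (C * 2 ^ Suc m) * exp (- \<bar>Re z\<bar>)"
      using C by (intro mult_left_mono) auto
    finally show ?thesis .
  qed
  then show ?thesis by blast
qed

lemma integral_strip_fun_edges:
  assumes m: "m \<ge> 2" and f: "\<And>t. strip_fun m k (Complex t (- 1/2)) - strip_fun m k (Complex t (1/2)) = 2 * \<i> * of_real (f t)"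
    and int: "integrable lborel f"
  shows "integral\<^sup>L lborel f = 0"
proof -
  obtain C where C: "\<And>z. z \<in> strip \<Longrightarrow> \<bar>Re z\<bar> \<ge> 1 \<Longrightarrow> norm (strip_fun m k z) \<le> C * exp (- \<bar>Re z\<bar>)"
    using norm_strip_fun_le[OF m] by blast
  have "integral\<^sup>L lborel (\<lambda>t. 2 * \<i> * complex_of_real (f t)) = 0"
  proof (rule integral_strip_edges[OF continuous_on_strip_fun _ C f[symmetric]])
    show "strip_fun m k field_differentiable at z" if "z \<in> interior strip - {0}" for z
      using that interior_subset by (intro field_differentiable_strip_fun) auto
    show "integrable lborel (\<lambda>t. 2 * \<i> * complex_of_real (f t))"
      using int by (intro integrable_mult_right integrable_of_real) auto
  qed auto
  then show ?thesis by simp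
qed

text \<open>
  The polynomial factor is \<open>(k + 1)\<^sup>2\<close> times the difference of two consecutive normalised products
  \<open>qprod (k + 1) / (k + 1)!\<^sup>2\<close> and \<open>qprod k / k!\<^sup>2\<close>, divided by the latter; the relation
  says that the moments do not depend on \<open>k\<close>.
\<close>

lemma strip_relation_weight:
  "(\<integral>t. qprod k t * (t * (t\<^sup>2 - real k - 3/4)) * (sinh (pi * t) / (cosh (pi * t))\<^sup>2) \<partial>lborel) = 0"
proof (rule integral_strip_fun_edges[where m = 2 and k = k])
  fix t
  define a b :: complex where "a = of_real (real k)" and "b = of_real t"
  have *: "(a + 1/2 + \<i> * b) * (b - \<i> / 2)\<^sup>2 - (a + 1/2 - \<i> * b) * (b + \<i> / 2)\<^sup>2
      = 2 * \<i> * (b * (b\<^sup>2 - a - 3/4))"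
    by (simp add: a_def b_def complex_eq_iff power2_eq_square field_simps)
  have z: "Complex t (- 1 / 2) = b - \<i> / 2" "Complex t (1 / 2) = b + \<i> / 2"
    by (auto simp: b_def complex_eq_iff)
  define X :: complex where "X = of_real (qprod k t * sinh (pi * t) / (cosh (pi * t))\<^sup>2)"
  have L: "strip_fun 2 k (b - \<i> / 2) = (a + 1/2 + \<i> * b) * (b - \<i> / 2)\<^sup>2 * X"
    using strip_fun_edge[of "-1" 2 k t] unfolding z(1) X_def[symmetric] by (simp add: a_def b_def)
  have R: "strip_fun 2 k (b + \<i> / 2) = (a + 1/2 - \<i> * b) * (b + \<i> / 2)\<^sup>2 * X"
    using strip_fun_edge[of 1 2 k t] unfolding z(2) X_def[symmetric] by (simp add: a_def b_def)
  show "strip_fun 2 k (Complex t (- 1 / 2)) - strip_fun 2 k (Complex t (1 / 2)) = 2 * \<i> *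
      of_real (qprod k t * (t * (t\<^sup>2 - real k - 3/4)) * (sinh (pi * t) / (cosh (pi * t))\<^sup>2))"
    unfolding z L R left_diff_distrib[symmetric] * by (simp add: a_def b_def X_def)
next
  show "integrable lborel (\<lambda>t. qprod k t * (t * (t\<^sup>2 - real k - 3 / 4)) * (sinh (pi * t) / (cosh (pi * t))\<^sup>2))"
    by (intro integrable_subexp_sinh_cosh subexp_intros)
qed auto

text \<open>
  The polynomial factor is now \<open>(k + 1)\<^sup>2\<close> times \<open>(k + 2) R (k + 1) - (k + 1) R k\<close>, divided by \<open>R k\<close>, where
  \<open>R k = qprod k / k!\<^sup>2\<close>.
\<close>

lemma strip_relation_symbol:
  "(\<integral>t. qprod k t * (t * ((real k + 2) * t\<^sup>2 - 3 * real k / 4 - 1/2)) * symbol t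
      * (sinh (pi * t) / (cosh (pi * t))\<^sup>2) \<partial>lborel) = 0" (is "(\<integral>t. ?f t \<partial>lborel) = 0")
proof -
  have "(\<integral>t. ?f t / pi \<partial>lborel) = 0"
  proof (rule integral_strip_fun_edges[where m = 3 and k = k])
    fix t
    define a b :: complex where "a = of_real (real k)" and "b = of_real t"
    have *: "\<i> * ((a + 1/2 + \<i> * b) * (b - \<i> / 2) ^ 3 + (a + 1/2 - \<i> * b) * (b + \<i> / 2) ^ 3)
        = 2 * \<i> * (b * ((a + 2) * b\<^sup>2 - 3 * a / 4 - 1/2))"
    proof -
      have 1: "(b - \<i> / 2) ^ 3 = Complex (t * t * t - 3 * t / 4) (1 / 8 - 3 * t * t / 2)"
        unfolding power3_eq_cube by (simp add: b_def complex_eq_iff) (simp add: field_simps)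
      have 2: "(b + \<i> / 2) ^ 3 = Complex (t * t * t - 3 * t / 4) (3 * t * t / 2 - 1 / 8)"
        unfolding power3_eq_cube by (simp add: b_def complex_eq_iff) (simp add: field_simps)
      show ?thesis unfolding 1 2
        by (simp add: a_def b_def complex_eq_iff power2_eq_square) (simp add: field_simps)
    qed
    have z: "Complex t (- 1 / 2) = b - \<i> / 2" "Complex t (1 / 2) = b + \<i> / 2"
      by (auto simp: b_def complex_eq_iff)
    have symbol: "?f t / pi = qprod k t * (t * ((real k + 2) * t\<^sup>2 - 3 * real k / 4 - 1/2))
        * (sinh (pi * t) / cosh (pi * t) ^ 3)"
      by (simp add: symbol_def power2_eq_square power3_eq_cube)
    define X :: complex where "X = of_real (qprod k t * sinh (pi * t) / cosh (pi * t) ^ 3)"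
    have i3: "\<i> ^ 3 = - \<i>" "(- \<i>) ^ 3 = \<i>" by (simp_all add: power3_eq_cube)
    have L: "strip_fun 3 k (b - \<i> / 2) = \<i> * ((a + 1/2 + \<i> * b) * (b - \<i> / 2) ^ 3) * X"
      using strip_fun_edge[of "-1" 3 k t] unfolding z(1) X_def[symmetric] by (simp add: a_def b_def i3)
    have R: "strip_fun 3 k (b + \<i> / 2) = - (\<i> * ((a + 1/2 - \<i> * b) * (b + \<i> / 2) ^ 3)) * X"
      using strip_fun_edge[of 1 3 k t] unfolding z(2) X_def[symmetric] by (simp add: a_def b_def i3)
    show "strip_fun 3 k (Complex t (- 1 / 2)) - strip_fun 3 k (Complex t (1 / 2)) = 2 * \<i> * of_real (?f t / pi)"
      unfolding symbol z L R left_diff_distrib[symmetric] diff_minus_eq_add distrib_left[symmetric] *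
      by (simp add: a_def b_def X_def)
  next
    show "integrable lborel (\<lambda>t. ?f t / pi)"
      by (intro integrable_divide integrable_subexp_sinh_cosh subexp_intros)
  qed auto
  then show ?thesis by (simp only: integral_divide_zero divide_eq_0_iff pi_neq_zero) simp
qed

lemma integral_weight: "(\<integral>t. weight t \<partial>lborel) = 1"
proof (rule integral_real_line_FTC[where F = "\<lambda>t. - t / cosh (pi * t) + 2 / pi * arctan (exp (pi * t))"])
  show "integrable lborel weight"
    using integrable_subexp_weight[OF subexp_const[of 1]] by simp
  fix t :: real
  have "exp (pi * t) / (1 + exp (pi * t) * exp (pi * t)) = 1 / (2 * cosh (pi * t))"
    by (simp add: cosh_field_def exp_minus divide_simps)
  then show "((\<lambda>t. - t / cosh (pi * t) + 2 / pi * arctan (exp (pi * t))) has_vector_derivative weight t) (at t)"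
    unfolding has_real_derivative_iff_has_vector_derivative[symmetric] weight_def
    by (auto intro!: derivative_eq_intros simp: power2_eq_square field_simps)
  show "(\<lambda>n. - real n / cosh (pi * real n) + 2 / pi * arctan (exp (pi * real n))
      - (- (- real n) / cosh (pi * (- real n)) + 2 / pi * arctan (exp (pi * (- real n))))) \<longlonglongrightarrow> 1"
    unfolding cosh_field_def by real_asymp
qed (intro continuous_intros)

lemma integral_symbol_weight: "(\<integral>t. symbol t * weight t \<partial>lborel) = 1"
proof (rule integral_real_line_FTC[where F = "\<lambda>t. - pi * t / (2 * (cosh (pi * t))\<^sup>2) + tanh (pi * t) / 2"])
  show "integrable lborel (\<lambda>t. symbol t * weight t)"
    by (intro integrable_subexp_weight subexp_intros)
  fix t :: real
  define c s where "c = cosh (pi * t)" and "s = sinh (pi * t)"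
  have c: "c \<noteq> 0" by (simp add: c_def)
  have cs: "s * s = c * c - 1" using cosh_square_eq[of "pi * t"] by (simp add: c_def s_def power2_eq_square)
  have "((\<lambda>t. - pi * t / (2 * (cosh (pi * t))\<^sup>2) + tanh (pi * t) / 2) has_real_derivative
     ((- pi) * (2 * c\<^sup>2) - (- pi * t) * (2 * (2 * c * (s * pi)))) / ((2 * c\<^sup>2) * (2 * c\<^sup>2))
      + (1 - (tanh (pi * t))\<^sup>2) * pi / 2) (at t)"
    using c unfolding c_def s_def
    by (auto intro!: derivative_eq_intros simp: diff_divide_distrib mult_ac)
  also have "(1 - (tanh (pi * t))\<^sup>2) = 1 / (c * c)"
    using c cs by (simp add: tanh_def c_def[symmetric] s_def[symmetric] power2_eq_square diff_divide_distrib)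
  also have "((- pi) * (2 * c\<^sup>2) - (- pi * t) * (2 * (2 * c * (s * pi)))) / ((2 * c\<^sup>2) * (2 * c\<^sup>2))
      + 1 / (c * c) * pi / 2 = symbol t * weight t"
    using c unfolding symbol_def weight_def c_def[symmetric] s_def[symmetric]
    by (simp add: field_simps eval_nat_numeral)
  finally show "((\<lambda>t. - pi * t / (2 * (cosh (pi * t))\<^sup>2) + tanh (pi * t) / 2) has_vector_derivative symbol t * weight t) (at t)"
    unfolding has_real_derivative_iff_has_vector_derivative[symmetric] .
  show "(\<lambda>n. - pi * real n / (2 * (cosh (pi * real n))\<^sup>2) + tanh (pi * real n) / 2
     - (- pi * (- real n) / (2 * (cosh (pi * (- real n)))\<^sup>2) + tanh (pi * (- real n)) / 2)) \<longlonglongrightarrow> 1"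
    unfolding cosh_field_def tanh_def sinh_field_def by real_asymp
qed (intro continuous_intros)

text \<open>
  The squared norm of the symbol.  It agrees with \<open>\<Sum> 1/(j+1)\<^sup>2\<close>, the squared norm of the first row of the
  Hilbert matrix, and this coincidence is what later gives the second power of the symbol.
\<close>

lemma integral_symbol_square_weight: "(\<integral>t. (symbol t)\<^sup>2 * weight t \<partial>lborel) = pi\<^sup>2 / 6"
proof (rule integral_real_line_FTC[where F = "\<lambda>t. - pi\<^sup>2 * t / (3 * cosh (pi * t) ^ 3)
    + pi / 6 * (sinh (pi * t) / (cosh (pi * t))\<^sup>2 + 2 * arctan (exp (pi * t)))"])
  show "integrable lborel (\<lambda>t. (symbol t)\<^sup>2 * weight t)"
    by (intro integrable_subexp_weight subexp_intros)
  fix t :: real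
  define c s e where "c = cosh (pi * t)" and "s = sinh (pi * t)" and "e = exp (pi * t)"
  have c: "c \<noteq> 0" by (simp add: c_def)
  have cs: "s * s = c * c - 1" using cosh_square_eq[of "pi * t"] by (simp add: c_def s_def power2_eq_square)
  have e: "inverse (1 + e\<^sup>2) * (e * pi) = pi / (2 * c)"
    by (simp add: c_def e_def cosh_field_def exp_minus divide_simps power2_eq_square)
  have "((\<lambda>t. - pi\<^sup>2 * t / (3 * cosh (pi * t) ^ 3)
    + pi / 6 * (sinh (pi * t) / (cosh (pi * t))\<^sup>2 + 2 * arctan (exp (pi * t)))) has_real_derivative
     ((- pi\<^sup>2) * (3 * c ^ 3) - (- pi\<^sup>2 * t) * (3 * (3 * c\<^sup>2 * (s * pi)))) / ((3 * c ^ 3) * (3 * c ^ 3))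
      + pi / 6 * ((c * pi * c\<^sup>2 - s * (2 * c * (s * pi))) / (c\<^sup>2 * c\<^sup>2) + 2 * (inverse (1 + e\<^sup>2) * (e * pi)))) (at t)"
    using c unfolding c_def s_def e_def
    by (auto intro!: derivative_eq_intros simp: diff_divide_distrib mult_ac)
  also have "((- pi\<^sup>2) * (3 * c ^ 3) - (- pi\<^sup>2 * t) * (3 * (3 * c\<^sup>2 * (s * pi)))) / ((3 * c ^ 3) * (3 * c ^ 3))
      + pi / 6 * ((c * pi * c\<^sup>2 - s * (2 * c * (s * pi))) / (c\<^sup>2 * c\<^sup>2) + 2 * (inverse (1 + e\<^sup>2) * (e * pi)))
      = (symbol t)\<^sup>2 * weight t"
  proof -
    have "c * pi * c\<^sup>2 - s * (2 * c * (s * pi)) = c * pi * (c\<^sup>2 - 2 * (s * s))" by (simp add: algebra_simps)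
    also have "\<dots> = c * pi * (2 - c\<^sup>2)" unfolding cs by (simp add: power2_eq_square algebra_simps)
    finally have 1: "c * pi * c\<^sup>2 - s * (2 * c * (s * pi)) = c * pi * (2 - c\<^sup>2)" .
    show ?thesis unfolding 1 e symbol_def weight_def c_def[symmetric] s_def[symmetric] using c
      by (simp add: field_simps eval_nat_numeral)
  qed
  finally show "((\<lambda>t. - pi\<^sup>2 * t / (3 * cosh (pi * t) ^ 3)
    + pi / 6 * (sinh (pi * t) / (cosh (pi * t))\<^sup>2 + 2 * arctan (exp (pi * t)))) has_vector_derivative (symbol t)\<^sup>2 * weight t) (at t)"
    unfolding has_real_derivative_iff_has_vector_derivative[symmetric] .
  show "(\<lambda>n. - pi\<^sup>2 * real n / (3 * cosh (pi * real n) ^ 3)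
    + pi / 6 * (sinh (pi * real n) / (cosh (pi * real n))\<^sup>2 + 2 * arctan (exp (pi * real n)))
     - (- pi\<^sup>2 * (- real n) / (3 * cosh (pi * (- real n)) ^ 3)
    + pi / 6 * (sinh (pi * (- real n)) / (cosh (pi * (- real n)))\<^sup>2 + 2 * arctan (exp (pi * (- real n))))))
     \<longlonglongrightarrow> pi\<^sup>2 / 6"
    unfolding cosh_field_def sinh_field_def power2_eq_square[of pi] by real_asymp
qed (intro continuous_intros)

lemma integral_qprod_weight: "(\<integral>t. qprod k t / (fact k)\<^sup>2 * weight t \<partial>lborel) = 1"
proof (induction k)
  case 0
  show ?case by (simp add: qprod_def integral_weight)
next
  case (Suc k)
  have "(\<integral>t. qprod (Suc k) t / (fact (Suc k))\<^sup>2 * weight t - qprod k t / (fact k)\<^sup>2 * weight t \<partial>lborel)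
      = (\<integral>t. pi / (fact (Suc k))\<^sup>2 * (qprod k t * (t * (t\<^sup>2 - real k - 3/4)) * (sinh (pi * t) / (cosh (pi * t))\<^sup>2)) \<partial>lborel)"
    by (intro Bochner_Integration.integral_cong refl)
      (simp add: qprod_def weight_def divide_simps power2_eq_square, simp add: algebra_simps)
  also have "\<dots> = 0" by (simp only: integral_mult_right_zero strip_relation_weight mult_zero_right)
  finally have "(\<integral>t. qprod (Suc k) t / (fact (Suc k))\<^sup>2 * weight t \<partial>lborel) = (\<integral>t. qprod k t / (fact k)\<^sup>2 * weight t \<partial>lborel)"
    by (subst (asm) Bochner_Integration.integral_diff) (auto intro!: integrable_subexp_weight subexp_intros simp del: fact_Suc)
  then show ?case unfolding Suc.IH .
qed

lemma integral_qprod_symbol_weight: "(\<integral>t. qprod k t / (fact k)\<^sup>2 * symbol t * weight t \<partial>lborel) = 1 / (real k + 1)"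
proof (induction k)
  case 0
  show ?case by (simp add: qprod_def integral_symbol_weight)
next
  case (Suc k)
  have "(\<integral>t. (real k + 2) * (qprod (Suc k) t / (fact (Suc k))\<^sup>2 * symbol t * weight t)
        - (real k + 1) * (qprod k t / (fact k)\<^sup>2 * symbol t * weight t) \<partial>lborel)
      = (\<integral>t. pi / (fact (Suc k))\<^sup>2 * (qprod k t * (t * ((real k + 2) * t\<^sup>2 - 3 * real k / 4 - 1/2)) * symbol t
      * (sinh (pi * t) / (cosh (pi * t))\<^sup>2)) \<partial>lborel)"
    by (intro Bochner_Integration.integral_cong refl)
      (simp add: qprod_def weight_def divide_simps power2_eq_square, simp add: algebra_simps)
  also have "\<dots> = 0" by (simp only: integral_mult_right_zero strip_relation_symbol mult_zero_right)
  finally have "(real k + 2) * (\<integral>t. qprod (Suc k) t / (fact (Suc k))\<^sup>2 * symbol t * weight t \<partial>lborel)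
      = (real k + 1) * (\<integral>t. qprod k t / (fact k)\<^sup>2 * symbol t * weight t \<partial>lborel)"
    by (subst (asm) Bochner_Integration.integral_diff)
      (auto intro!: integrable_mult_right integrable_subexp_weight subexp_intros simp del: fact_Suc)
  also have "\<dots> = 1" unfolding Suc.IH by simp
  finally have "(real k + 2) * (\<integral>t. qprod (Suc k) t / (fact (Suc k))\<^sup>2 * symbol t * weight t \<partial>lborel) = 1" .
  moreover have "real k + 2 \<noteq> 0" by linarith
  moreover have "real (Suc k) + 1 = real k + 2" by simp
  ultimately show ?case by (metis nonzero_mult_div_cancel_left)
qed

section \<open>The commuting Jacobi matrix\<close>

text \<open>
  A Jacobi matrix that commutes with the Hilbert matrix.  It is the matrix, in the basis of the powers of \<open>z\<close>, of
  the differential operator \<open>f \<mapsto> (z (1 - z)\<^sup>2 f')' + (z - 1) f\<close>, which commutes with the integral operator with kernel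
  \<open>1 / (1 - t z)\<close> on \<open>[0, 1]\<close>.  The truncated subtraction at \<open>n = 0\<close> is harmless because its
  coefficient vanishes.
\<close>

definition jacobi :: "(nat \<Rightarrow> real) \<Rightarrow> nat \<Rightarrow> real" where
  "jacobi f n = (real n + 1)\<^sup>2 * f (Suc n) - (2 * (real n)\<^sup>2 + 2 * real n + 1) * f n + (real n)\<^sup>2 * f (n - 1)"

lemma jacobi_cmult: "jacobi (\<lambda>n. c * f n) n = c * jacobi f n"
  by (simp add: jacobi_def algebra_simps)

lemma jacobi_sum: "jacobi (\<lambda>n. \<Sum>j\<in>A. f j n) n = (\<Sum>j\<in>A. jacobi (f j) n)"
  by (simp add: jacobi_def sum_distrib_left sum.distrib sum_subtractf)

text \<open>
  Up to sign, this is the coefficient of \<open>qprod k / k!\<^sup>2\<close> in \<open>(1/4 + t\<^sup>2) hahn n\<close>, so it amounts to the recursion of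
  the \<open>hahn\<close> polynomials.
\<close>

lemma jacobi_choose:
  "jacobi (\<lambda>n. real (n choose k)) n
    = (real k)\<^sup>2 * real (n choose (k - 1)) + ((real k)\<^sup>2 + real k) * real (n choose k)"
proof -
  have absorb: "real n * real ((n - 1) choose k) = (real n - real k) * real (n choose k)"
  proof (cases "n = 0")
    case False
    then obtain i where n: "n = Suc i" using not0_implies_Suc by blast
    show ?thesis
    proof (cases "k \<le> n")
      case True
      have "(Suc i - k) * (Suc i choose k) = Suc i * (i choose k)"
        using binomial_absorb_comp[of "Suc i" k] by simp
      then have "real (Suc i - k) * real (Suc i choose k) = real (Suc i) * real (i choose k)"
        by (metis of_nat_mult)
      then show ?thesis using True by (simp add: n of_nat_diff)
    qed (simp add: n binomial_eq_0)
  qed (cases k; simp)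
  have sq: "(real n)\<^sup>2 * real ((n - 1) choose k) = real n * (real n - real k) * real (n choose k)"
    using absorb by (simp add: power2_eq_square)
  show ?thesis
  proof (cases k)
    case 0
    then show ?thesis by (simp add: jacobi_def power2_eq_square algebra_simps)
  next
    case (Suc j)
    define x y where "x = real (n choose j)" and "y = real (n choose k)"
    have "Suc j * (n choose Suc j) = (n - j) * (n choose j)"
      unfolding binomial_absorb_comp by (rule binomial_absorption)
    then have "real (Suc j) * real (n choose Suc j) = real (n - j) * real (n choose j)"
      by (metis of_nat_mult)
    moreover have "real (n - j) * real (n choose j) = (real n - real j) * real (n choose j)"
      by (cases "j \<le> n") (auto simp: of_nat_diff)
    ultimately have ky: "real k * y = (real n + 1 - real k) * x"
      by (simp add: x_def y_def Suc)
    have "jacobi (\<lambda>n. real (n choose k)) n = (real n + 1)\<^sup>2 * (x + y)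
        - (2 * (real n)\<^sup>2 + 2 * real n + 1) * y + real n * (real n - real k) * y"
      unfolding jacobi_def sq by (simp add: x_def y_def Suc)
    also have "\<dots> = (real n + 1)\<^sup>2 * x - (real n + 1 + real k) * (real k * y)
        + ((real k)\<^sup>2 + real k) * y"
      by (simp add: power2_eq_square algebra_simps)
    also have "\<dots> = (real k)\<^sup>2 * x + ((real k)\<^sup>2 + real k) * y"
      unfolding ky by (simp add: power2_eq_square algebra_simps)
    finally show ?thesis by (simp add: x_def y_def Suc)
  qed
qed

lemma hahn_eq_sum:
  assumes "n \<le> N"
  shows "hahn n t = (\<Sum>k\<le>N. (-1) ^ k * real (n choose k) * (qprod k t / (fact k)\<^sup>2))"
  unfolding hahn_def using assms by (intro sum.mono_neutral_left) auto

text \<open>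
  The three-term recursion.  In terms of \<open>R k = qprod k / k!\<^sup>2\<close>, multiplication by \<open>1/4 + t\<^sup>2\<close>
  raises \<open>k\<close> by at most one, so that both sides can be compared coefficientwise.
\<close>

lemma jacobi_hahn: "jacobi (\<lambda>n. hahn n t) n = - (1/4 + t\<^sup>2) * hahn n t"
proof -
  define R where "R k = qprod k t / (fact k)\<^sup>2" for k
  have R: "(1/4 + t\<^sup>2) * R k = (real k + 1)\<^sup>2 * R (Suc k) - ((real k)\<^sup>2 + real k) * R k" for k
  proof -
    have "(real k + 1)\<^sup>2 * R (Suc k) = ((real k + 1/2)\<^sup>2 + t\<^sup>2) * R k"
      by (simp add: R_def qprod_def power_mult_distrib divide_simps add.commute)
    then show ?thesis by (simp add: power2_eq_square algebra_simps)
  qed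
  have "jacobi (\<lambda>n. hahn n t) n = jacobi (\<lambda>i. \<Sum>k\<le>Suc n. ((-1) ^ k * R k) * real (i choose k)) n"
    unfolding jacobi_def R_def using hahn_eq_sum[of _ "Suc n" t]
    by (simp add: mult_ac del: sum.atMost_Suc)
  also have "\<dots> = (\<Sum>k\<le>Suc n. (-1) ^ k * R k *
      ((real k)\<^sup>2 * real (n choose (k - 1)) + ((real k)\<^sup>2 + real k) * real (n choose k)))"
    unfolding jacobi_sum jacobi_cmult jacobi_choose ..
  also have "\<dots> = (\<Sum>k\<le>Suc n. (-1) ^ k * R k * ((real k)\<^sup>2 * real (n choose (k - 1))))
      + (\<Sum>k\<le>Suc n. (-1) ^ k * R k * (((real k)\<^sup>2 + real k) * real (n choose k)))"
    by (simp only: distrib_left sum.distrib)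
  also have "(\<Sum>k\<le>Suc n. (-1) ^ k * R k * ((real k)\<^sup>2 * real (n choose (k - 1))))
      = (\<Sum>k\<le>n. - ((-1) ^ k * real (n choose k) * ((real k + 1)\<^sup>2 * R (Suc k))))"
    unfolding sum.atMost_Suc_shift by (simp add: algebra_simps)
  also have "(\<Sum>k\<le>Suc n. (-1) ^ k * R k * (((real k)\<^sup>2 + real k) * real (n choose k)))
      = (\<Sum>k\<le>n. (-1) ^ k * real (n choose k) * (((real k)\<^sup>2 + real k) * R k))"
    by (simp add: mult_ac binomial_eq_0)
  also have "(\<Sum>k\<le>n. - ((-1) ^ k * real (n choose k) * ((real k + 1)\<^sup>2 * R (Suc k)))) + \<dots>
      = (\<Sum>k\<le>n. - (1/4 + t\<^sup>2) * ((-1) ^ k * real (n choose k) * R k))"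
  proof (subst sum.distrib[symmetric], intro sum.cong refl)
    fix k
    have "- ((-1) ^ k * real (n choose k) * ((real k + 1)\<^sup>2 * R (Suc k)))
        + (-1) ^ k * real (n choose k) * (((real k)\<^sup>2 + real k) * R k)
        = - ((-1) ^ k * real (n choose k) * ((real k + 1)\<^sup>2 * R (Suc k) - ((real k)\<^sup>2 + real k) * R k))"
      by (simp only: right_diff_distrib)
    also have "\<dots> = - (1/4 + t\<^sup>2) * ((-1) ^ k * real (n choose k) * R k)"
      unfolding R[symmetric] by (simp only: mult_minus_left mult_ac)
    finally show "- ((-1) ^ k * real (n choose k) * ((real k + 1)\<^sup>2 * R (Suc k)))
        + (-1) ^ k * real (n choose k) * (((real k)\<^sup>2 + real k) * R k)
        = - (1/4 + t\<^sup>2) * ((-1) ^ k * real (n choose k) * R k)" .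
  qed
  also have "\<dots> = - (1/4 + t\<^sup>2) * hahn n t"
    by (simp only: sum_distrib_left[symmetric] hahn_def R_def)
  finally show ?thesis .
qed

text \<open>
  Since the Jacobi matrix is symmetric, this says that it commutes with the matrix \<open>B\<close>.
\<close>

definition jacobi_commute :: "(nat \<Rightarrow> nat \<Rightarrow> real) \<Rightarrow> bool" where
  "jacobi_commute B \<longleftrightarrow> (\<forall>n m. jacobi (\<lambda>i. B i m) n = jacobi (\<lambda>j. B n j) m)"

text \<open>
  The relation at row \<open>n\<close> can be solved for row \<open>n + 1\<close>, since the coefficient \<open>(n + 1)\<^sup>2\<close> is nonzero.
\<close>

lemma jacobi_commute_eqI:
  assumes A: "jacobi_commute A" and B: "jacobi_commute B" and 0: "\<And>m. A 0 m = B 0 m"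
  shows "A n m = B n m"
proof (induction n arbitrary: m rule: less_induct)
  case (less n)
  show ?case
  proof (cases n)
    case 0
    then show ?thesis using assms(3) by simp
  next
    case (Suc i)
    have "A i = B i" "A (i - 1) = B (i - 1)"
      using less.IH[of i] less.IH[of "i - 1"] by (auto simp: Suc)
    moreover have "jacobi (\<lambda>i. A i m) i = jacobi (\<lambda>j. A i j) m" "jacobi (\<lambda>i. B i m) i = jacobi (\<lambda>j. B i j) m"
      using A B by (auto simp: jacobi_commute_def)
    ultimately have "jacobi (\<lambda>i. A i m) i = jacobi (\<lambda>i. B i m) i" by metis
    then show ?thesis
      using \<open>A i = B i\<close> \<open>A (i - 1) = B (i - 1)\<close> by (simp add: jacobi_def Suc)
  qed
qed

definition hilb :: "nat \<Rightarrow> nat \<Rightarrow> real" where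
  "hilb n m = 1 / (real n + real m + 1)"

lemma hilb_commute: "hilb n m = hilb m n"
  by (simp add: hilb_def add.commute)

lemma jacobi_hilb: "jacobi (\<lambda>i. hilb i m) n = (real n + 1)\<^sup>2 / (real n + real m + 2)
    - (2 * (real n)\<^sup>2 + 2 * real n + 1) / (real n + real m + 1) + (real n)\<^sup>2 / (real n + real m)"
  by (cases n) (auto simp: jacobi_def hilb_def add_ac)

lemma jacobi_commute_hilb: "jacobi_commute hilb"
  unfolding jacobi_commute_def
proof (intro allI)
  fix n m
  define a b where "a = real n" and "b = real m"
  have ab: "a \<ge> 0" "b \<ge> 0" by (simp_all add: a_def b_def)
  have "jacobi (\<lambda>j. hilb n j) m = jacobi (\<lambda>j. hilb j n) m" by (simp add: hilb_commute)
  moreover have "(a + 1)\<^sup>2 / (a + b + 2) - (2 * a\<^sup>2 + 2 * a + 1) / (a + b + 1) + a\<^sup>2 / (a + b)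
     - ((b + 1)\<^sup>2 / (a + b + 2) - (2 * b\<^sup>2 + 2 * b + 1) / (a + b + 1) + b\<^sup>2 / (a + b)) = 0"
  proof -
    have "(a + 1)\<^sup>2 / (a + b + 2) - (b + 1)\<^sup>2 / (a + b + 2) = a - b"
      using ab by (simp add: diff_divide_distrib[symmetric] divide_eq_eq) (simp add: power2_eq_square algebra_simps)
    moreover have "(2 * a\<^sup>2 + 2 * a + 1) / (a + b + 1) - (2 * b\<^sup>2 + 2 * b + 1) / (a + b + 1) = 2 * (a - b)"
      using ab by (simp add: diff_divide_distrib[symmetric] divide_eq_eq) (simp add: power2_eq_square algebra_simps)
    moreover have "a\<^sup>2 / (a + b) - b\<^sup>2 / (a + b) = a - b"
      using ab by (simp add: diff_divide_distrib[symmetric] divide_eq_eq) (simp add: power2_eq_square algebra_simps)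
    moreover have "x - y + z - (x' - y' + z') = (x - x') - (y - y') + (z - z')"
      for x y z x' y' z' :: real by simp
    ultimately show ?thesis by (simp only:) simp
  qed
  ultimately show "jacobi (\<lambda>i. hilb i m) n = jacobi (\<lambda>j. hilb n j) m"
    unfolding jacobi_hilb by (simp add: a_def b_def add.commute)
qed

definition hilb_square :: "nat \<Rightarrow> nat \<Rightarrow> real" where
  "hilb_square n m = (\<Sum>j. hilb n j * hilb j m)"

lemma sums_hilb_square: "(\<lambda>j. hilb n j * hilb j m) sums hilb_square n m"
proof -
  have "summable (\<lambda>j. hilb n j * hilb j m)"
  proof (rule summable_comparison_test')
    show "summable (\<lambda>j. 1 / (real (Suc j))\<^sup>2)"
      using inverse_squares_sums by (simp add: sums_iff add.commute)
    fix j
    have "hilb n j * hilb j m \<le> (1 / real (Suc j)) * (1 / real (Suc j))"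
      unfolding hilb_def by (intro mult_mono divide_left_mono) auto
    then show "norm (hilb n j * hilb j m) \<le> 1 / (real (Suc j))\<^sup>2"
      by (simp add: hilb_def power2_eq_square)
  qed
  then show ?thesis by (simp add: hilb_square_def summable_sums)
qed

text \<open>
  Summation by parts for the symmetric Jacobi matrix; only the boundary term survives.
\<close>

lemma jacobi_Green:
  "(\<Sum>j<N. jacobi a j * b j - a j * jacobi b j) = (real N)\<^sup>2 * (a N * b (N - 1) - a (N - 1) * b N)"
proof (induction N)
  case (Suc N)
  then show ?case by (cases N) (simp_all add: jacobi_def algebra_simps)
qed simp

lemma jacobi_tendsto:
  assumes "\<And>n. (\<lambda>N. f N n) \<longlonglongrightarrow> l n"
  shows "(\<lambda>N. jacobi (f N) n) \<longlonglongrightarrow> jacobi l n"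
  unfolding jacobi_def by (intro tendsto_intros assms)

text \<open>
  The infinite matrix product is associative here because the boundary term of Green's formula is
  of order \<open>1 / N\<^sup>2\<close>.
\<close>

lemma jacobi_commute_hilb_square: "jacobi_commute hilb_square"
  unfolding jacobi_commute_def
proof (intro allI)
  fix n m
  define S where "S N n m = (\<Sum>j<N. hilb n j * hilb j m)" for N n m
  have S: "(\<lambda>N. S N n m) \<longlonglongrightarrow> hilb_square n m" for n m
    using sums_hilb_square unfolding sums_def S_def .
  have "jacobi (\<lambda>i. S N i m) n - jacobi (\<lambda>i. S N n i) m = (real N)\<^sup>2 * (hilb n N * hilb (N - 1) m - hilb n (N - 1) * hilb N m)" for N
  proof -
    have "jacobi (\<lambda>i. S N i m) n = (\<Sum>j<N. hilb j m * jacobi (\<lambda>i. hilb i j) n)"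
      unfolding S_def jacobi_sum by (simp add: mult.commute[of _ "hilb _ m"] jacobi_cmult)
    also have "\<dots> = (\<Sum>j<N. jacobi (\<lambda>j. hilb n j) j * hilb j m)"
      using jacobi_commute_hilb by (simp add: jacobi_commute_def mult.commute)
    finally have 1: "jacobi (\<lambda>i. S N i m) n = (\<Sum>j<N. jacobi (\<lambda>j. hilb n j) j * hilb j m)" .
    have "jacobi (\<lambda>i. S N n i) m = (\<Sum>j<N. hilb n j * jacobi (\<lambda>i. hilb j i) m)"
      unfolding S_def jacobi_sum jacobi_cmult ..
    also have "\<dots> = (\<Sum>j<N. hilb n j * jacobi (\<lambda>j. hilb j m) j)"
      using jacobi_commute_hilb by (simp add: jacobi_commute_def)
    finally have 2: "jacobi (\<lambda>i. S N n i) m = (\<Sum>j<N. hilb n j * jacobi (\<lambda>j. hilb j m) j)" .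
    show ?thesis
      unfolding 1 2 sum_subtractf[symmetric] by (rule jacobi_Green)
  qed
  moreover have "(\<lambda>N. (real N)\<^sup>2 * (hilb n N * hilb (N - 1) m - hilb n (N - 1) * hilb N m)) \<longlonglongrightarrow> 0"
  proof (rule Lim_transform_eventually)
    show "(\<lambda>N. (real N)\<^sup>2 * (1 / (real n + real N + 1) * (1 / (real N + real m))
        - 1 / (real n + real N) * (1 / (real N + real m + 1)))) \<longlonglongrightarrow> 0"
      by real_asymp
    show "\<forall>\<^sub>F N in sequentially. (real N)\<^sup>2 * (1 / (real n + real N + 1) * (1 / (real N + real m))
        - 1 / (real n + real N) * (1 / (real N + real m + 1)))
        = (real N)\<^sup>2 * (hilb n N * hilb (N - 1) m - hilb n (N - 1) * hilb N m)"
      using eventually_gt_at_top[of 0]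
      by eventually_elim (simp add: hilb_def of_nat_diff Suc_le_eq)
  qed
  ultimately have "(\<lambda>N. jacobi (\<lambda>i. S N i m) n - jacobi (\<lambda>i. S N n i) m) \<longlonglongrightarrow> 0" by simp
  moreover have "(\<lambda>N. jacobi (\<lambda>i. S N i m) n - jacobi (\<lambda>i. S N n i) m) \<longlonglongrightarrow> jacobi (\<lambda>i. hilb_square i m) n - jacobi (\<lambda>i. hilb_square n i) m"
    by (intro tendsto_diff jacobi_tendsto S)
  ultimately show "jacobi (\<lambda>i. hilb_square i m) n = jacobi (\<lambda>j. hilb_square n j) m"
    using LIMSEQ_unique by fastforce
qed

section \<open>Gram matrices of the polynomials\<close>

definition spec_int :: "(real \<Rightarrow> real) \<Rightarrow> real" where
  "spec_int f = (\<integral>t. f t * weight t \<partial>lborel)"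

lemma spec_int_add: "subexp f \<Longrightarrow> subexp g \<Longrightarrow> spec_int (\<lambda>t. f t + g t) = spec_int f + spec_int g"
  unfolding spec_int_def by (simp add: distrib_right integrable_subexp_weight)

lemma spec_int_diff: "subexp f \<Longrightarrow> subexp g \<Longrightarrow> spec_int (\<lambda>t. f t - g t) = spec_int f - spec_int g"
  unfolding spec_int_def by (simp add: left_diff_distrib integrable_subexp_weight)

lemma spec_int_cmult: "spec_int (\<lambda>t. c * f t) = c * spec_int f"
  unfolding spec_int_def by (simp add: mult.assoc)

lemma spec_int_sum: "(\<And>i. i \<in> A \<Longrightarrow> subexp (f i)) \<Longrightarrow> spec_int (\<lambda>t. \<Sum>i\<in>A. f i t) = (\<Sum>i\<in>A. spec_int (f i))"
  unfolding spec_int_def by (simp add: sum_distrib_right integrable_subexp_weight)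

lemma spec_int_mono:
  assumes "subexp f" "subexp g" "\<And>t. f t \<le> g t"
  shows "spec_int f \<le> spec_int g"
  unfolding spec_int_def using assms
  by (intro integral_mono integrable_subexp_weight mult_right_mono weight_nonneg) auto

lemma spec_int_nonneg: "(\<And>t. f t \<ge> 0) \<Longrightarrow> spec_int f \<ge> 0"
  unfolding spec_int_def by (intro Bochner_Integration.integral_nonneg) (auto simp: weight_nonneg)

lemma spec_int_Cauchy_Schwarz:
  assumes "subexp f" "subexp g"
  shows "(spec_int (\<lambda>t. f t * g t))\<^sup>2 \<le> spec_int (\<lambda>t. (f t)\<^sup>2) * spec_int (\<lambda>t. (g t)\<^sup>2)"
proof -
  define a b c where "a = spec_int (\<lambda>t. (f t)\<^sup>2)" and "b = spec_int (\<lambda>t. f t * g t)" and "c = spec_int (\<lambda>t. (g t)\<^sup>2)"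
  have q: "0 \<le> x * x * a + y * (2 * x * b) + y * y * c" for x y
  proof -
    have "0 \<le> spec_int (\<lambda>t. (x * f t + y * g t)\<^sup>2)" by (intro spec_int_nonneg) simp
    also have "(\<lambda>t. (x * f t + y * g t)\<^sup>2)
        = (\<lambda>t. x * x * (f t)\<^sup>2 + y * (2 * x) * (f t * g t) + y * y * (g t)\<^sup>2)"
      by (simp add: fun_eq_iff power2_eq_square algebra_simps)
    also have "spec_int \<dots> = x * x * a + y * (2 * x * b) + y * y * c"
      unfolding a_def b_def c_def using assms by (simp add: spec_int_add spec_int_cmult subexp_intros)
    finally show ?thesis .
  qed
  have a: "a \<ge> 0" and c: "c \<ge> 0" unfolding a_def c_def by (auto intro: spec_int_nonneg)
  have "b * b \<le> a * c"
  proof (cases "c = 0")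
    case True
    have "b = 0"
    proof (rule ccontr)
      assume "b \<noteq> 0"
      then show False using q[of 1 "- (a + 1) / (2 * b)"] True by (simp add: field_simps)
    qed
    then show ?thesis using True by simp
  next
    case False
    then have "c > 0" using c by simp
    \<comment> \<open>The minimising choice for the quadratic form, up to scaling.\<close>
    have "0 \<le> c * (c * a - b * b)" using q[of c "- b"] by (simp add: algebra_simps)
    then show ?thesis using \<open>c > 0\<close> by (simp add: zero_le_mult_iff mult.commute)
  qed
  then show ?thesis by (simp add: a_def b_def c_def power2_eq_square)
qed

definition gram :: "(real \<Rightarrow> real) \<Rightarrow> nat \<Rightarrow> nat \<Rightarrow> real" where
  "gram f n m = spec_int (\<lambda>t. f t * (hahn n t * hahn m t))"

lemma gram_commute: "gram f n m = gram f m n"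
  by (simp add: gram_def mult.commute)

lemma jacobi_gram:
  assumes "subexp f"
  shows "jacobi (\<lambda>i. gram f i m) n = spec_int (\<lambda>t. - (1/4 + t\<^sup>2) * (f t * (hahn n t * hahn m t)))"
proof -
  have "jacobi (\<lambda>i. gram f i m) n = spec_int (\<lambda>t. (real n + 1)\<^sup>2 * (f t * (hahn (Suc n) t * hahn m t))
      - (2 * (real n)\<^sup>2 + 2 * real n + 1) * (f t * (hahn n t * hahn m t)) + (real n)\<^sup>2 * (f t * (hahn (n - 1) t * hahn m t)))"
    unfolding jacobi_def gram_def using assms by (simp add: spec_int_add spec_int_diff spec_int_cmult subexp_intros)
  also have "\<dots> = spec_int (\<lambda>t. (f t * hahn m t) * jacobi (\<lambda>i. hahn i t) n)"
    by (simp add: jacobi_def algebra_simps)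
  finally show ?thesis unfolding jacobi_hahn by (simp only: mult_ac)
qed

lemma jacobi_commute_gram:
  assumes "subexp f" shows "jacobi_commute (gram f)"
  unfolding jacobi_commute_def
proof (intro allI)
  fix n m
  have "jacobi (\<lambda>j. gram f n j) m = jacobi (\<lambda>j. gram f j n) m" by (simp add: gram_commute[of f n])
  then show "jacobi (\<lambda>i. gram f i m) n = jacobi (\<lambda>j. gram f n j) m"
    by (simp only: jacobi_gram[OF assms] mult.commute[of "hahn n _" "hahn m _"])
qed

lemma hahn_0: "hahn 0 t = 1"
  by (simp add: hahn_def qprod_def)

lemma gram_0:
  assumes "subexp f"
  shows "gram f 0 m = (\<Sum>k\<le>m. (-1) ^ k * real (m choose k) * spec_int (\<lambda>t. qprod k t / (fact k)\<^sup>2 * f t))"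
proof -
  have "gram f 0 m = spec_int (\<lambda>t. \<Sum>k\<le>m. (-1) ^ k * real (m choose k) * (qprod k t / (fact k)\<^sup>2 * f t))"
    unfolding gram_def hahn_0 hahn_def[of m] by (simp add: sum_distrib_left mult_ac)
  also have "\<dots> = (\<Sum>k\<le>m. (-1) ^ k * real (m choose k) * spec_int (\<lambda>t. qprod k t / (fact k)\<^sup>2 * f t))"
    by (subst spec_int_sum, intro subexp_intros assms, simp only: spec_int_cmult)
  finally show ?thesis .
qed

definition kronecker :: "nat \<Rightarrow> nat \<Rightarrow> real" where
  "kronecker n m = (if n = m then 1 else 0)"

lemma jacobi_commute_kronecker: "jacobi_commute kronecker"
proof -
  have "jacobi (\<lambda>i. kronecker i m) n = jacobi (\<lambda>j. kronecker n j) m" for n m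
    by (cases n; cases m) (auto simp: jacobi_def kronecker_def add_ac)
  then show ?thesis by (simp add: jacobi_commute_def)
qed

text \<open>
  Orthonormality of the polynomials.  All normalised moments are one, so the first row is an alternating
  sum of binomial coefficients.
\<close>

lemma gram_one: "gram (\<lambda>_. 1) n m = kronecker n m"
proof (rule jacobi_commute_eqI[OF jacobi_commute_gram jacobi_commute_kronecker])
  fix m
  have "gram (\<lambda>_. 1) 0 m = (\<Sum>k\<le>m. (-1) ^ k * real (m choose k))"
    by (simp add: gram_0 subexp_const spec_int_def integral_qprod_weight del: times_divide_eq_left)
  also have "\<dots> = kronecker 0 m"
    using choose_alternating_sum[of m, where 'a = real] by (cases "m = 0") (auto simp: kronecker_def)
  finally show "gram (\<lambda>_. 1) 0 m = kronecker 0 m" .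
qed (rule subexp_const)

text \<open>
  The Hilbert matrix is the compression of the multiplication operator: the moments \<open>1 / (k + 1)\<close> turn the first
  row into the binomial expansion of \<open>\<integral>(1 - y)\<^sup>m dy\<close> over \<open>[0, 1]\<close>.
\<close>

lemma gram_symbol: "gram symbol n m = hilb n m"
proof (rule jacobi_commute_eqI[OF jacobi_commute_gram jacobi_commute_hilb])
  fix m
  have "gram symbol 0 m = (\<Sum>k\<le>m. (-1) ^ k * real (m choose k) * (1 / (real k + 1)))"
    by (simp add: gram_0 subexp_symbol spec_int_def integral_qprod_symbol_weight del: times_divide_eq_left)
  also have "\<dots> = (\<Sum>k\<le>m. ((-1) ^ k * real (Suc m choose Suc k)) / (real m + 1))"
  proof (intro sum.cong refl)
    fix k
    have "real (Suc k) * real (Suc m choose Suc k) = real (Suc m) * real (m choose k)"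
      by (metis Suc_times_binomial_eq of_nat_mult mult.commute)
    then have "real (m choose k) / (real k + 1) = real (Suc m choose Suc k) / (real m + 1)"
      by (simp add: field_simps del: binomial_Suc_Suc)
    then show "(-1) ^ k * real (m choose k) * (1 / (real k + 1))
        = ((-1) ^ k * real (Suc m choose Suc k)) / (real m + 1)"
      by (metis mult.right_neutral times_divide_eq_right)
  qed
  also have "\<dots> = (\<Sum>k\<le>m. (-1) ^ k * real (Suc m choose Suc k)) / (real m + 1)"
    by (rule sum_divide_distrib[symmetric])
  also have "(\<Sum>k\<le>m. (-1) ^ k * real (Suc m choose Suc k)) = 1"
  proof -
    have "0 = (\<Sum>k\<le>Suc m. (-1) ^ k * real (Suc m choose k))"
      using choose_alternating_sum[of "Suc m", where 'a = real] by simp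
    also have "\<dots> = 1 - (\<Sum>k\<le>m. (-1) ^ k * real (Suc m choose Suc k))"
      unfolding sum.atMost_Suc_shift by (simp add: sum_negf del: binomial_Suc_Suc)
    finally show ?thesis by simp
  qed
  finally show "gram symbol 0 m = hilb 0 m" by (simp add: hilb_def)
qed (rule subexp_symbol)

definition hilb_partial :: "nat \<Rightarrow> real \<Rightarrow> real" where
  "hilb_partial N t = (\<Sum>j<N. hilb 0 j * hahn j t)"

lemma subexp_hilb_partial: "subexp (hilb_partial N)"
  unfolding hilb_partial_def[abs_def] by (intro subexp_intros)

lemma spec_int_symbol_partial: "spec_int (\<lambda>t. symbol t * hahn m t * hilb_partial N t) = (\<Sum>j<N. hilb 0 j * hilb j m)"
proof -
  have "spec_int (\<lambda>t. symbol t * hahn m t * hilb_partial N t) = spec_int (\<lambda>t. \<Sum>j<N. hilb 0 j * (symbol t * (hahn j t * hahn m t)))"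
    by (simp add: hilb_partial_def sum_distrib_left mult_ac)
  also have "\<dots> = (\<Sum>j<N. hilb 0 j * gram symbol j m)"
    unfolding gram_def by (subst spec_int_sum) (auto intro!: subexp_intros simp: spec_int_cmult)
  finally show ?thesis by (simp add: gram_symbol)
qed

lemma spec_int_partial_sq: "spec_int (\<lambda>t. (hilb_partial N t)\<^sup>2) = (\<Sum>j<N. (hilb 0 j)\<^sup>2)"
proof -
  have "spec_int (\<lambda>t. (hilb_partial N t)\<^sup>2) = spec_int (\<lambda>t. \<Sum>i<N. \<Sum>j<N. (hilb 0 i * hilb 0 j) * (1 * (hahn i t * hahn j t)))"
    by (simp add: hilb_partial_def power2_eq_square sum_product mult_ac)
  also have "\<dots> = (\<Sum>i<N. \<Sum>j<N. (hilb 0 i * hilb 0 j) * gram (\<lambda>_. 1) i j)"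
    unfolding gram_def by (subst spec_int_sum, force intro!: subexp_intros, intro sum.cong refl,
      subst spec_int_sum) (auto intro!: subexp_intros simp: spec_int_cmult)
  also have "\<dots> = (\<Sum>i<N. (hilb 0 i)\<^sup>2)"
    by (simp add: gram_one kronecker_def power2_eq_square if_distrib[of "(*) _"] cong: if_cong)
  finally show ?thesis .
qed

text \<open>
  The symbol lies in the closed span of the polynomials: Bessel's inequality is an equality
  for it, by the evaluation of \<open>\<zeta>(2)\<close>.
\<close>

lemma symbol_approx: "(\<lambda>N. spec_int (\<lambda>t. (symbol t - hilb_partial N t)\<^sup>2)) \<longlonglongrightarrow> 0"
proof -
  have "spec_int (\<lambda>t. (symbol t - hilb_partial N t)\<^sup>2) = pi\<^sup>2 / 6 - (\<Sum>j<N. 1 / (real j + 1)\<^sup>2)" for N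
  proof -
    have "spec_int (\<lambda>t. (symbol t - hilb_partial N t)\<^sup>2) = spec_int (\<lambda>t. (symbol t)\<^sup>2 - 2 * (symbol t * hahn 0 t * hilb_partial N t) + (hilb_partial N t)\<^sup>2)"
      by (simp add: hahn_0 power2_diff algebra_simps)
    also have "\<dots> = spec_int (\<lambda>t. (symbol t)\<^sup>2) - 2 * spec_int (\<lambda>t. symbol t * hahn 0 t * hilb_partial N t) + spec_int (\<lambda>t. (hilb_partial N t)\<^sup>2)"
      by (simp add: spec_int_add spec_int_diff spec_int_cmult subexp_intros subexp_hilb_partial)
    also have "spec_int (\<lambda>t. (symbol t)\<^sup>2) = pi\<^sup>2 / 6" unfolding spec_int_def by (rule integral_symbol_square_weight)
    finally show ?thesis
      unfolding spec_int_symbol_partial spec_int_partial_sq by (simp add: hilb_def power2_eq_square)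
  qed
  moreover have "(\<lambda>N. pi\<^sup>2 / 6 - (\<Sum>j<N. 1 / (real j + 1)\<^sup>2)) \<longlonglongrightarrow> pi\<^sup>2 / 6 - pi\<^sup>2 / 6"
    using inverse_squares_sums by (intro tendsto_intros) (simp add: sums_def add.commute)
  ultimately show ?thesis by simp
qed

text \<open>
  The square of a compression is in general not the compression of the square.  Here the two agree
  in the first row, because the symbol is the limit of its expansion and can be replaced by it term by
  term, and the commuting Jacobi matrix carries the equality to all rows.
\<close>

lemma gram_symbol_square: "gram (\<lambda>t. (symbol t)\<^sup>2) n m = hilb_square n m"
proof (rule jacobi_commute_eqI[OF jacobi_commute_gram jacobi_commute_hilb_square])
  fix m
  have lim: "(\<lambda>N. spec_int (\<lambda>t. symbol t * hahn m t * hilb_partial N t)) \<longlonglongrightarrow> hilb_square 0 m"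
    using sums_hilb_square[of 0 m] unfolding spec_int_symbol_partial sums_def .
  define c where "c = spec_int (\<lambda>t. (symbol t * hahn m t)\<^sup>2)"
  have "(\<lambda>N. (spec_int (\<lambda>t. symbol t * hahn m t * (symbol t - hilb_partial N t)))\<^sup>2) \<longlonglongrightarrow> 0"
  proof (rule tendsto_sandwich[OF _ _ tendsto_const])
    show "\<forall>\<^sub>F N in sequentially. (spec_int (\<lambda>t. symbol t * hahn m t * (symbol t - hilb_partial N t)))\<^sup>2
        \<le> c * spec_int (\<lambda>t. (symbol t - hilb_partial N t)\<^sup>2)"
      unfolding c_def by (intro always_eventually allI spec_int_Cauchy_Schwarz subexp_intros subexp_hilb_partial)
    show "(\<lambda>N. c * spec_int (\<lambda>t. (symbol t - hilb_partial N t)\<^sup>2)) \<longlonglongrightarrow> 0"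
      using tendsto_mult_right_zero[OF symbol_approx] .
  qed simp
  then have "(\<lambda>N. spec_int (\<lambda>t. symbol t * hahn m t * (symbol t - hilb_partial N t))) \<longlonglongrightarrow> 0"
    by (simp add: power_tendsto_0_iff)
  moreover have "spec_int (\<lambda>t. symbol t * hahn m t * (symbol t - hilb_partial N t))
      = gram (\<lambda>t. (symbol t)\<^sup>2) 0 m - spec_int (\<lambda>t. symbol t * hahn m t * hilb_partial N t)" for N
    unfolding gram_def hahn_0 by (subst spec_int_diff[symmetric])
      (auto intro!: subexp_intros subexp_hilb_partial simp: power2_eq_square algebra_simps)
  ultimately have "(\<lambda>N. gram (\<lambda>t. (symbol t)\<^sup>2) 0 m - spec_int (\<lambda>t. symbol t * hahn m t * hilb_partial N t)) \<longlonglongrightarrow> 0"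
    by simp
  then have "(\<lambda>N. spec_int (\<lambda>t. symbol t * hahn m t * hilb_partial N t)) \<longlonglongrightarrow> gram (\<lambda>t. (symbol t)\<^sup>2) 0 m"
    using tendsto_diff[OF tendsto_const[of "gram (\<lambda>t. (symbol t)\<^sup>2) 0 m"]] by fastforce
  then show "gram (\<lambda>t. (symbol t)\<^sup>2) 0 m = hilb_square 0 m"
    using lim by (rule LIMSEQ_unique)
qed (intro subexp_intros)

section \<open>The isometry\<close>

definition expand_hahn :: "nat \<Rightarrow> (nat \<Rightarrow> complex) \<Rightarrow> real \<Rightarrow> complex" where
  "expand_hahn N u t = (\<Sum>n<N. u n * of_real (hahn n t))"

lemma real_isometry:
  fixes u v :: "nat \<Rightarrow> real"
  shows "(\<lambda>i. ((if i < N then u i else 0) + (\<Sum>j<N. hilb i j * v j))\<^sup>2) sums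
    spec_int (\<lambda>t. ((\<Sum>n<N. u n * hahn n t) + symbol t * (\<Sum>n<N. v n * hahn n t))\<^sup>2)"
proof -
  have "(\<lambda>i. (if i \<in> {..<N} then (u i)\<^sup>2 else 0)
      + (if i \<in> {..<N} then 2 * u i * (\<Sum>j<N. hilb i j * v j) else 0)
      + (\<Sum>j<N. \<Sum>k<N. (v j * v k) * (hilb j i * hilb i k))) sums
    ((\<Sum>i<N. (u i)\<^sup>2) + (\<Sum>i<N. 2 * u i * (\<Sum>j<N. hilb i j * v j))
      + (\<Sum>j<N. \<Sum>k<N. (v j * v k) * hilb_square j k))"
    by (intro sums_add sums_If_finite_set sums_sum sums_mult sums_hilb_square) auto
  also have "(\<lambda>i. (if i \<in> {..<N} then (u i)\<^sup>2 else 0)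
      + (if i \<in> {..<N} then 2 * u i * (\<Sum>j<N. hilb i j * v j) else 0)
      + (\<Sum>j<N. \<Sum>k<N. (v j * v k) * (hilb j i * hilb i k)))
    = (\<lambda>i. ((if i < N then u i else 0) + (\<Sum>j<N. hilb i j * v j))\<^sup>2)"
  proof
    fix i
    have "(\<Sum>j<N. \<Sum>k<N. (v j * v k) * (hilb j i * hilb i k)) = (\<Sum>j<N. hilb i j * v j)\<^sup>2"
      by (simp add: power2_eq_square sum_product hilb_commute[of _ i] mult_ac)
    then show "(if i \<in> {..<N} then (u i)\<^sup>2 else 0)
      + (if i \<in> {..<N} then 2 * u i * (\<Sum>j<N. hilb i j * v j) else 0)
      + (\<Sum>j<N. \<Sum>k<N. (v j * v k) * (hilb j i * hilb i k))
      = ((if i < N then u i else 0) + (\<Sum>j<N. hilb i j * v j))\<^sup>2"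
      by (simp add: power2_sum)
  qed
  also have "(\<Sum>i<N. (u i)\<^sup>2) + (\<Sum>i<N. 2 * u i * (\<Sum>j<N. hilb i j * v j))
      + (\<Sum>j<N. \<Sum>k<N. (v j * v k) * hilb_square j k)
    = spec_int (\<lambda>t. ((\<Sum>n<N. u n * hahn n t) + symbol t * (\<Sum>n<N. v n * hahn n t))\<^sup>2)"
  proof -
    have expand: "spec_int (\<lambda>t. f t * ((\<Sum>n<N. a n * hahn n t) * (\<Sum>n<N. b n * hahn n t)))
        = (\<Sum>i<N. \<Sum>j<N. (a i * b j) * gram f i j)" if "subexp f" for f a b
    proof -
      have "f t * ((\<Sum>n<N. a n * hahn n t) * (\<Sum>n<N. b n * hahn n t))
          = (\<Sum>i<N. \<Sum>j<N. (a i * b j) * (f t * (hahn i t * hahn j t)))" for t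
      proof -
        have "(\<Sum>n<N. a n * hahn n t) * (\<Sum>n<N. b n * hahn n t)
            = (\<Sum>i<N. \<Sum>j<N. (a i * hahn i t) * (b j * hahn j t))" by (rule sum_product)
        then show ?thesis by (simp only: sum_distrib_left mult_ac)
      qed
      then have "spec_int (\<lambda>t. f t * ((\<Sum>n<N. a n * hahn n t) * (\<Sum>n<N. b n * hahn n t)))
        = spec_int (\<lambda>t. \<Sum>i<N. \<Sum>j<N. (a i * b j) * (f t * (hahn i t * hahn j t)))"
        by (simp only:)
      also have "\<dots> = (\<Sum>i<N. \<Sum>j<N. (a i * b j) * gram f i j)"
        unfolding gram_def using that by (subst spec_int_sum, force intro!: subexp_intros,
          intro sum.cong refl, subst spec_int_sum) (auto intro!: subexp_intros simp: spec_int_cmult)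
      finally show ?thesis .
    qed
    define U V where "U t = (\<Sum>n<N. u n * hahn n t)" and "V t = (\<Sum>n<N. v n * hahn n t)" for t
    have UV: "subexp U" "subexp V" unfolding U_def[abs_def] V_def[abs_def] by (intro subexp_intros)+
    have "spec_int (\<lambda>t. (U t + symbol t * V t)\<^sup>2)
        = spec_int (\<lambda>t. 1 * (U t * U t) + 2 * (symbol t * (U t * V t)) + (symbol t)\<^sup>2 * (V t * V t))"
      by (simp add: power2_eq_square algebra_simps)
    also have "\<dots> = spec_int (\<lambda>t. 1 * (U t * U t)) + 2 * spec_int (\<lambda>t. symbol t * (U t * V t))
        + spec_int (\<lambda>t. (symbol t)\<^sup>2 * (V t * V t))"
      using UV by (simp add: spec_int_add spec_int_cmult subexp_intros)
    also have "spec_int (\<lambda>t. 1 * (U t * U t)) = (\<Sum>i<N. (u i)\<^sup>2)"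
      unfolding U_def expand[OF subexp_const]
      by (simp add: gram_one kronecker_def power2_eq_square if_distrib[of "(*) _"] cong: if_cong)
    also have "2 * spec_int (\<lambda>t. symbol t * (U t * V t)) = (\<Sum>i<N. 2 * u i * (\<Sum>j<N. hilb i j * v j))"
      unfolding U_def V_def expand[OF subexp_symbol] gram_symbol
      by (simp add: sum_distrib_left mult_ac)
    also have "spec_int (\<lambda>t. (symbol t)\<^sup>2 * (V t * V t)) = (\<Sum>j<N. \<Sum>k<N. (v j * v k) * hilb_square j k)"
      unfolding V_def expand[OF subexp_power[OF subexp_symbol]] gram_symbol_square ..
    finally show ?thesis unfolding U_def V_def by simp
  qed
  finally show ?thesis .
qed

lift_definition trunc :: "nat \<Rightarrow> (nat \<Rightarrow> complex) \<Rightarrow> ell2" is "\<lambda>N u n. if n < N then u n else 0"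
proof -
  fix N and u :: "nat \<Rightarrow> complex"
  have "summable (\<lambda>n. if n \<in> {..<N} then (norm (u n))\<^sup>2 else 0)"
    by (rule summable_If_finite_set) simp
  then show "summable (\<lambda>n. (norm (if n < N then u n else 0))\<^sup>2)"
    by (rule back_subst[of summable]) auto
qed

lemma ell2_norm_sums: "(\<lambda>n. (norm (ell2_coord x n))\<^sup>2) sums (norm x)\<^sup>2"
proof transfer
  fix x :: "nat \<Rightarrow> complex"
  assume x: "summable (\<lambda>n. (norm (x n))\<^sup>2)"
  then have "0 \<le> (\<Sum>n. (norm (x n))\<^sup>2)" by (intro suminf_nonneg) auto
  then show "(\<lambda>n. (norm (x n))\<^sup>2) sums (sqrt (\<Sum>n. (norm (x n))\<^sup>2))\<^sup>2"
    using x by (simp add: summable_sums)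
qed

lemma ell2_norm_eqI: "(\<lambda>n. (norm (ell2_coord x n))\<^sup>2) sums c \<Longrightarrow> (norm x)\<^sup>2 = c"
  using ell2_norm_sums sums_unique2 by blast

lemma ell2_partial_sum_le:
  "finite A \<Longrightarrow> (\<Sum>n\<in>A. (norm (ell2_coord x n))\<^sup>2) \<le> (norm x)\<^sup>2"
  using sum_le_suminf[of "\<lambda>n. (norm (ell2_coord x n))\<^sup>2" A] ell2_norm_sums[of x]
  by (auto simp: sums_iff)

lemma hilbert_trunc_coord:
  "ell2_coord (hilbert_matrix (trunc N v)) i = (\<Sum>j<N. of_real (hilb i j) * v j)"
proof transfer
  fix N v i
  have "(\<Sum>j. (if j < N then v j else 0) / of_nat (i + j + 1))
      = (\<Sum>j<N. (if j < N then v j else 0) / of_nat (i + j + 1) :: complex)"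
    by (rule suminf_finite) auto
  also have "\<dots> = (\<Sum>j<N. of_real (hilb i j) * v j)"
    by (intro sum.cong refl) (simp add: hilb_def)
  finally show "(\<Sum>j. (if j < N then v j else 0) / of_nat (i + j + 1))
      = (\<Sum>j<N. of_real (hilb i j) * v j)" .
qed

text \<open>
  The spectral representation in the form in which it is used: with \<open>v = 0\<close> it is an isometry, and for \<open>u = - l v\<close> it
  compares \<open>H - l\<close> with multiplication by \<open>symbol - l\<close>.
\<close>

lemma isometry:
  "spec_int (\<lambda>t. (norm (expand_hahn N u t + of_real (symbol t) * expand_hahn N v t))\<^sup>2)
    = (norm (trunc N u + hilbert_matrix (trunc N v)))\<^sup>2"
proof -
  let ?f = "\<lambda>u v t. (\<Sum>n<N. u n * hahn n t) + symbol t * (\<Sum>n<N. v n * hahn n t)"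
  let ?Re = "?f (\<lambda>n. Re (u n)) (\<lambda>n. Re (v n))"
  let ?Im = "?f (\<lambda>n. Im (u n)) (\<lambda>n. Im (v n))"
  have "spec_int (\<lambda>t. (norm (expand_hahn N u t + of_real (symbol t) * expand_hahn N v t))\<^sup>2)
      = spec_int (\<lambda>t. (?Re t)\<^sup>2 + (?Im t)\<^sup>2)"
    by (simp add: cmod_power2 expand_hahn_def)
  also have "\<dots> = spec_int (\<lambda>t. (?Re t)\<^sup>2) + spec_int (\<lambda>t. (?Im t)\<^sup>2)"
    by (intro spec_int_add subexp_intros)
  also have "\<dots> = (norm (trunc N u + hilbert_matrix (trunc N v)))\<^sup>2"
  proof (rule ell2_norm_eqI[symmetric])
    have coord: "ell2_coord (trunc N u + hilbert_matrix (trunc N v)) i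
        = (if i < N then u i else 0) + (\<Sum>j<N. of_real (hilb i j) * v j)" for i
      by (simp add: plus_ell2.rep_eq hilbert_trunc_coord trunc.rep_eq)
    have "(norm (ell2_coord (trunc N u + hilbert_matrix (trunc N v)) i))\<^sup>2
        = ((if i < N then Re (u i) else 0) + (\<Sum>j<N. hilb i j * Re (v j)))\<^sup>2
        + ((if i < N then Im (u i) else 0) + (\<Sum>j<N. hilb i j * Im (v j)))\<^sup>2" for i
      unfolding coord by (simp add: cmod_power2)
    then show "(\<lambda>i. (norm (ell2_coord (trunc N u + hilbert_matrix (trunc N v)) i))\<^sup>2) sums
        (spec_int (\<lambda>t. (?Re t)\<^sup>2) + spec_int (\<lambda>t. (?Im t)\<^sup>2))"
      by (simp only:) (intro sums_add real_isometry)
  qed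
  finally show ?thesis .
qed

lemma trunc_tendsto: "(\<lambda>N. trunc N (ell2_coord x)) \<longlonglongrightarrow> x"
proof -
  let ?f = "\<lambda>n. (norm (ell2_coord x n))\<^sup>2"
  have "(norm (x - trunc N (ell2_coord x)))\<^sup>2 = (norm x)\<^sup>2 - (\<Sum>n<N. ?f n)" for N
  proof (rule ell2_norm_eqI)
    have "(\<lambda>n. ?f n - (if n \<in> {..<N} then ?f n else 0)) sums ((norm x)\<^sup>2 - (\<Sum>n<N. ?f n))"
      by (intro sums_diff ell2_norm_sums sums_If_finite_set) auto
    also have "(\<lambda>n. ?f n - (if n \<in> {..<N} then ?f n else 0))
        = (\<lambda>n. (norm (ell2_coord (x - trunc N (ell2_coord x)) n))\<^sup>2)"
      by (auto simp: fun_eq_iff minus_ell2.rep_eq trunc.rep_eq)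
    finally show "(\<lambda>n. (norm (ell2_coord (x - trunc N (ell2_coord x)) n))\<^sup>2) sums
        ((norm x)\<^sup>2 - (\<Sum>n<N. ?f n))" .
  qed
  moreover have "(\<lambda>N. (norm x)\<^sup>2 - (\<Sum>n<N. ?f n)) \<longlonglongrightarrow> (norm x)\<^sup>2 - (norm x)\<^sup>2"
    using ell2_norm_sums[of x] by (intro tendsto_diff tendsto_const) (simp add: sums_def)
  ultimately have "(\<lambda>N. (norm (x - trunc N (ell2_coord x)))\<^sup>2) \<longlonglongrightarrow> 0" by simp
  then have "(\<lambda>N. norm (x - trunc N (ell2_coord x))) \<longlonglongrightarrow> 0"
    by (simp add: power_tendsto_0_iff)
  then show ?thesis
    by (simp add: LIMSEQ_iff norm_minus_commute)
qed

lemma norm_coord_le: "norm (ell2_coord x n) \<le> norm x"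
proof -
  have "(norm (ell2_coord x n))\<^sup>2 \<le> (norm x)\<^sup>2"
    using ell2_partial_sum_le[of "{n}" x] by simp
  then show ?thesis by (rule power2_le_imp_le) simp
qed

section \<open>Completeness and fixed points\<close>

lemma complete_ell2: "complete (UNIV :: ell2 set)"
  unfolding complete_def
proof (intro allI impI, elim conjE)
  fix X :: "nat \<Rightarrow> ell2"
  assume X: "Cauchy X"
  have "\<exists>l. (\<lambda>k. ell2_coord (X k) n) \<longlonglongrightarrow> l" for n
  proof -
    have "Cauchy (\<lambda>k. ell2_coord (X k) n)"
      unfolding Cauchy_iff
    proof (intro allI impI)
      fix e :: real assume "e > 0"
      then obtain M where M: "\<And>k l. k \<ge> M \<Longrightarrow> l \<ge> M \<Longrightarrow> norm (X k - X l) < e"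
        using X unfolding Cauchy_iff by blast
      have "norm (ell2_coord (X k) n - ell2_coord (X l) n) \<le> norm (X k - X l)" for k l
        using norm_coord_le[of "X k - X l" n] by (simp add: minus_ell2.rep_eq)
      then show "\<exists>M. \<forall>k\<ge>M. \<forall>l\<ge>M. norm (ell2_coord (X k) n - ell2_coord (X l) n) < e"
        using M by (meson order.strict_trans1)
    qed
    then have "convergent (\<lambda>k. ell2_coord (X k) n)" by (simp only: Cauchy_convergent_iff)
    then show ?thesis by (simp only: convergent_def)
  qed
  then obtain y where y: "\<And>n. (\<lambda>k. ell2_coord (X k) n) \<longlonglongrightarrow> y n" by metis
  have bound: "\<exists>M. \<forall>k\<ge>M. \<forall>N. (\<Sum>n<N. (norm (ell2_coord (X k) n - y n))\<^sup>2) \<le> e\<^sup>2"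
    if "e > 0" for e
  proof -
    obtain M where M: "\<And>k l. k \<ge> M \<Longrightarrow> l \<ge> M \<Longrightarrow> norm (X k - X l) < e"
      using X \<open>e > 0\<close> unfolding Cauchy_iff by blast
    have "(\<Sum>n<N. (norm (ell2_coord (X k) n - y n))\<^sup>2) \<le> e\<^sup>2" if k: "k \<ge> M" for k N
    proof (rule LIMSEQ_le_const2)
      show "(\<lambda>l. \<Sum>n<N. (norm (ell2_coord (X k) n - ell2_coord (X l) n))\<^sup>2)
          \<longlonglongrightarrow> (\<Sum>n<N. (norm (ell2_coord (X k) n - y n))\<^sup>2)"
        by (intro tendsto_intros y)
      have "(\<Sum>n<N. (norm (ell2_coord (X k) n - ell2_coord (X l) n))\<^sup>2) \<le> e\<^sup>2" if "l \<ge> M" for l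
      proof -
        have "(\<Sum>n<N. (norm (ell2_coord (X k - X l) n))\<^sup>2) \<le> (norm (X k - X l))\<^sup>2"
          by (rule ell2_partial_sum_le) simp
        also have "\<dots> \<le> e\<^sup>2" using M[OF k that] by (intro power_mono) auto
        finally show ?thesis by (simp add: minus_ell2.rep_eq)
      qed
      then show "\<exists>L. \<forall>l\<ge>L. (\<Sum>n<N. (norm (ell2_coord (X k) n - ell2_coord (X l) n))\<^sup>2) \<le> e\<^sup>2"
        by blast
    qed
    then show ?thesis by blast
  qed
  have sq: "summable (\<lambda>n. (norm (ell2_coord (X k) n - y n))\<^sup>2)"
    if "\<forall>N. (\<Sum>n<N. (norm (ell2_coord (X k) n - y n))\<^sup>2) \<le> e\<^sup>2" for k and e :: real
    using that by (intro summableI_nonneg_bounded[where x = "e\<^sup>2"]) auto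
  obtain k0 where "summable (\<lambda>n. (norm (ell2_coord (X k0) n - y n))\<^sup>2)"
    using bound[of 1] sq[where e = 1] by auto
  then have "summable (\<lambda>n. (norm (ell2_coord (X k0) n + - (ell2_coord (X k0) n - y n)))\<^sup>2)"
    using ell2_coord[of "X k0"] by (intro summable_norm_add_squares) (auto simp: norm_minus_commute)
  then have "summable (\<lambda>n. (norm (y n))\<^sup>2)" by simp
  then have Y: "ell2_coord (Abs_ell2 y) = y" by (simp add: Abs_ell2_inverse)
  have "X \<longlonglongrightarrow> Abs_ell2 y"
    unfolding LIMSEQ_iff
  proof (intro allI impI)
    fix e :: real assume "e > 0"
    then obtain M where M: "\<And>k N. k \<ge> M \<Longrightarrow> (\<Sum>n<N. (norm (ell2_coord (X k) n - y n))\<^sup>2) \<le> (e / 2)\<^sup>2"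
      using bound[of "e / 2"] by auto
    have "norm (X k - Abs_ell2 y) < e" if k: "k \<ge> M" for k
    proof -
      have "(norm (X k - Abs_ell2 y))\<^sup>2 \<le> (e / 2)\<^sup>2"
        using LIMSEQ_le_const2[OF ell2_norm_sums[of "X k - Abs_ell2 y", unfolded sums_def]] M[OF k]
        by (simp add: minus_ell2.rep_eq Y)
      then have "norm (X k - Abs_ell2 y) \<le> e / 2"
        by (rule power2_le_imp_le) (use \<open>e > 0\<close> in simp)
      then show ?thesis using \<open>e > 0\<close> by simp
    qed
    then show "\<exists>M. \<forall>k\<ge>M. norm (X k - Abs_ell2 y) < e" by blast
  qed
  then show "\<exists>l\<in>UNIV. X \<longlonglongrightarrow> l" by blast
qed

lemma contraction_fixed_point:
  fixes f :: "ell2 \<Rightarrow> ell2"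
  assumes "q < 1" "\<And>x y. norm (f x - f y) \<le> q * norm (x - y)"
  obtains x where "f x = x"
proof -
  have "\<exists>!x\<in>UNIV. f x = x"
  proof (rule Banach_fix[OF complete_ell2])
    show "dist (f x) (f y) \<le> max q 0 * dist x y" for x y
      using order_trans[OF assms(2) mult_right_mono[of q "max q 0" "norm (x - y)"]]
      by (simp add: dist_norm)
  qed (use assms in auto)
  then show ?thesis using that by blast
qed

section \<open>Transfer between sequences and functions\<close>

lemma ell2_eqI: "(\<And>n. ell2_coord x n = ell2_coord y n) \<Longrightarrow> x = y"
  by (simp add: ell2_coord_inject[symmetric] fun_eq_iff)

lemmas ell2_coord_simps = plus_ell2.rep_eq minus_ell2.rep_eq uminus_ell2.rep_eq scaleC.rep_eq
  zero_ell2.rep_eq trunc.rep_eq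

lemma norm_scaleC: "norm (c *\<^sub>C x) = norm c * norm x"
proof -
  have "(\<lambda>n. (norm (ell2_coord (c *\<^sub>C x) n))\<^sup>2) sums ((norm c)\<^sup>2 * (norm x)\<^sup>2)"
    using sums_mult[OF ell2_norm_sums[of x], of "(norm c)\<^sup>2"]
    by (simp add: scaleC.rep_eq norm_mult power_mult_distrib)
  from ell2_norm_eqI[OF this] have "(norm (c *\<^sub>C x))\<^sup>2 = (norm c * norm x)\<^sup>2"
    by (simp add: power_mult_distrib)
  then show ?thesis by (rule power2_eq_imp_eq) auto
qed

lemma scaleC_of_real: "of_real r *\<^sub>C x = r *\<^sub>R x"
  by (rule ell2_eqI) (simp add: scaleC.rep_eq scaleR_ell2.rep_eq scaleR_conv_of_real)

lemma bounded_linear_scaleC: "bounded_linear (\<lambda>x. c *\<^sub>C x)"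
proof (rule bounded_linear_intro)
  show "c *\<^sub>C (x + y) = c *\<^sub>C x + c *\<^sub>C y" for x y
    by (rule ell2_eqI) (simp add: ell2_coord_simps distrib_left)
  show "c *\<^sub>C (r *\<^sub>R x) = r *\<^sub>R (c *\<^sub>C x)" for r x
    by (rule ell2_eqI) (simp add: ell2_coord_simps scaleR_ell2.rep_eq)
  show "norm (c *\<^sub>C x) \<le> norm x * norm c" for x
    by (simp add: norm_scaleC mult.commute)
qed

lemmas scaleC_diff_right = linear_diff[OF bounded_linear.linear[OF bounded_linear_scaleC]]

lemma bounded_linear_hilbert_matrix: "bounded_linear hilbert_matrix"
  and hilbert_matrix_scaleC: "hilbert_matrix (c *\<^sub>C x) = c *\<^sub>C hilbert_matrix x"
  using bounded_clinear_hilbert_matrix by (auto simp: bounded_clinear_def)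

lemmas tendsto_hilbert_matrix = bounded_linear.tendsto[OF bounded_linear_hilbert_matrix]
lemmas tendsto_scaleC = bounded_linear.tendsto[OF bounded_linear_scaleC]

definition csubexp :: "(real \<Rightarrow> complex) \<Rightarrow> bool" where
  "csubexp f \<longleftrightarrow> subexp (\<lambda>t. Re (f t)) \<and> subexp (\<lambda>t. Im (f t))"

lemma csubexp_intros:
  shows "csubexp (\<lambda>_. c)" and "subexp r \<Longrightarrow> csubexp (\<lambda>t. of_real (r t))"
    and "csubexp f \<Longrightarrow> csubexp g \<Longrightarrow> csubexp (\<lambda>t. f t + g t)"
    and "csubexp f \<Longrightarrow> csubexp g \<Longrightarrow> csubexp (\<lambda>t. f t - g t)"
    and "csubexp f \<Longrightarrow> csubexp g \<Longrightarrow> csubexp (\<lambda>t. f t * g t)"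
    and "(\<And>i. i \<in> A \<Longrightarrow> csubexp (F i)) \<Longrightarrow> csubexp (\<lambda>t. \<Sum>i\<in>A. F i t)"
  by (auto simp: csubexp_def intro!: subexp_intros)

lemma csubexp_expand_hahn: "csubexp (expand_hahn N u)"
  unfolding expand_hahn_def[abs_def] by (intro csubexp_intros subexp_intros)

lemma subexp_norm_sq: "csubexp f \<Longrightarrow> subexp (\<lambda>t. (norm (f t))\<^sup>2)"
  by (auto simp: csubexp_def cmod_power2 intro!: subexp_intros)

lemmas csubexp_rules = csubexp_intros csubexp_expand_hahn subexp_norm_sq subexp_intros

lemma expand_hahn_cmult: "expand_hahn N (\<lambda>n. c * u n) t = c * expand_hahn N u t"
  by (simp add: expand_hahn_def sum_distrib_left mult_ac)

lemma trunc_cmult: "trunc N (\<lambda>n. c * u n) = c *\<^sub>C trunc N u"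
  by (rule ell2_eqI) (simp add: ell2_coord_simps)

lemma isometry_affine:
  "spec_int (\<lambda>t. (norm ((a + b * of_real (symbol t)) * expand_hahn N u t))\<^sup>2)
    = (norm (a *\<^sub>C trunc N u + b *\<^sub>C hilbert_matrix (trunc N u)))\<^sup>2"
  using isometry[of N "\<lambda>n. a * u n" "\<lambda>n. b * u n"]
  by (simp add: expand_hahn_cmult trunc_cmult hilbert_matrix_scaleC algebra_simps)

lemma isometry_id:
  "spec_int (\<lambda>t. (norm (expand_hahn N u t))\<^sup>2) = (norm (trunc N u))\<^sup>2"
proof -
  have "1 *\<^sub>C trunc N u + 0 *\<^sub>C hilbert_matrix (trunc N u) = trunc N u"
    by (rule ell2_eqI) (simp add: ell2_coord_simps)
  then show ?thesis using isometry_affine[of 1 0 N u] by simp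
qed

lemma isometry_minus:
  "spec_int (\<lambda>t. (norm ((of_real (symbol t) - l) * expand_hahn N u t))\<^sup>2)
    = (norm (hilbert_matrix (trunc N u) - l *\<^sub>C trunc N u))\<^sup>2"
proof -
  have "(- l) *\<^sub>C trunc N u + 1 *\<^sub>C hilbert_matrix (trunc N u) = hilbert_matrix (trunc N u) - l *\<^sub>C trunc N u"
    by (rule ell2_eqI) (simp add: ell2_coord_simps)
  then show ?thesis using isometry_affine[of "- l" 1 N u] by simp
qed

lemma isometry_diff:
  assumes "M \<le> N"
  shows "spec_int (\<lambda>t. (norm (expand_hahn N u t - expand_hahn M u t))\<^sup>2) = (norm (trunc N u - trunc M u))\<^sup>2"
proof -
  let ?u = "\<lambda>n. if n < M then 0 else u n"
  have "expand_hahn N ?u t + expand_hahn M u t = expand_hahn N u t" for t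
  proof -
    have "expand_hahn M u t = (\<Sum>n<N. (if n < M then u n else 0) * of_real (hahn n t))"
      unfolding expand_hahn_def using assms by (intro sum.mono_neutral_cong_left) auto
    then show ?thesis
      by (auto simp: expand_hahn_def sum.distrib[symmetric] intro!: sum.cong)
  qed
  then have "expand_hahn N ?u t = expand_hahn N u t - expand_hahn M u t" for t
    by (simp add: eq_diff_eq)
  moreover have "trunc N ?u = trunc N u - trunc M u"
    using assms by (intro ell2_eqI) (auto simp: ell2_coord_simps)
  ultimately show ?thesis using isometry_id[of N ?u] by simp
qed

lemma norm_sq_split: "(norm a)\<^sup>2 \<le> 2 * (norm (a - b))\<^sup>2 + 2 * (norm b)\<^sup>2" for a b :: complex
proof -
  have "(norm a)\<^sup>2 \<le> (norm (a - b) + norm b)\<^sup>2"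
    using norm_triangle_ineq[of "a - b" b] by (intro power_mono) auto
  also have "\<dots> \<le> 2 * (norm (a - b))\<^sup>2 + 2 * (norm b)\<^sup>2"
    using sum_squares_ge_zero[of "norm (a - b) - norm b" 0] by (simp add: power2_eq_square algebra_simps)
  finally show ?thesis .
qed

section \<open>Absence of eigenvalues\<close>

lemma null_symbol_level: "{t. complex_of_real (symbol t) = l} \<in> null_sets lborel"
proof (rule finite_imp_null_set_lborel)
  show "finite {t. complex_of_real (symbol t) = l}"
  proof (cases "\<exists>s. complex_of_real (symbol s) = l")
    case True
    then obtain s where s: "complex_of_real (symbol s) = l" by blast
    have "{t. complex_of_real (symbol t) = l} \<subseteq> {s, - s}"
    proof
      fix t assume "t \<in> {t. complex_of_real (symbol t) = l}"
      then have "cosh (pi * t) = cosh (pi * s)" using s by (auto simp: symbol_def)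
      then show "t \<in> {s, - s}" by (auto simp: abs_mult abs_eq_iff)
    qed
    then show ?thesis using finite_subset by blast
  qed auto
qed

text \<open>
  A continuous substitute for restricting the integral to a shrinking neighbourhood of the level set of \<open>l\<close>.
\<close>

lemma cutoff_tendsto:
  fixes l :: complex
  assumes "subexp f" "\<And>t. f t \<ge> 0"
  shows "(\<lambda>k. spec_int (\<lambda>t. f t / (1 + real k * (norm (of_real (symbol t) - l))\<^sup>2))) \<longlonglongrightarrow> 0"
proof -
  have "(\<lambda>k. \<integral>t. f t / (1 + real k * (norm (of_real (symbol t) - l))\<^sup>2) * weight t \<partial>lborel)
      \<longlonglongrightarrow> (\<integral>t. 0 \<partial>(lborel :: real measure))"
  proof (rule integral_dominated_convergence[where w = "\<lambda>t. f t * weight t"])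
    show "integrable lborel (\<lambda>t. f t * weight t)" by (rule integrable_subexp_weight) fact
    have "continuous_on UNIV f" using assms by (simp add: subexp_def)
    moreover have "1 + real k * (norm (of_real (symbol t) - l))\<^sup>2 \<noteq> 0" for k t
      by (metis add.commute add_nonneg_eq_0_iff of_nat_0_le_iff zero_le_mult_iff zero_le_one zero_le_power2 zero_neq_one)
    ultimately have "continuous_on UNIV (\<lambda>t. f t / (1 + real k * (norm (of_real (symbol t) - l))\<^sup>2) * weight t)" for k
      by (intro continuous_intros) auto
    from borel_measurable_continuous_onI[OF this]
    show "(\<lambda>t. f t / (1 + real k * (norm (of_real (symbol t) - l))\<^sup>2) * weight t) \<in> borel_measurable lborel" for k
      by simp
    show "AE t in lborel. norm (f t / (1 + real k * (norm (of_real (symbol t) - l))\<^sup>2) * weight t) \<le> f t * weight t" for k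
    proof (rule AE_I2)
      fix t
      have "f t / (1 + real k * (norm (of_real (symbol t) - l))\<^sup>2) \<le> f t / 1"
        using assms(2)[of t] by (intro divide_left_mono) (auto intro: add_pos_nonneg)
      then have "f t / (1 + real k * (norm (of_real (symbol t) - l))\<^sup>2) * weight t \<le> f t * weight t"
        using weight_nonneg[of t] by (intro mult_right_mono) auto
      moreover have "0 \<le> f t / (1 + real k * (norm (of_real (symbol t) - l))\<^sup>2) * weight t"
        using assms(2)[of t] weight_nonneg[of t] by (intro mult_nonneg_nonneg divide_nonneg_nonneg) auto
      ultimately show "norm (f t / (1 + real k * (norm (of_real (symbol t) - l))\<^sup>2) * weight t) \<le> f t * weight t"
        unfolding real_norm_def by (subst abs_of_nonneg)
    qed
    show "AE t in lborel. (\<lambda>k. f t / (1 + real k * (norm (of_real (symbol t) - l))\<^sup>2) * weight t) \<longlonglongrightarrow> 0"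
      using AE_not_in[OF null_symbol_level[of l]]
    proof eventually_elim
      case (elim t)
      then have d: "(norm (of_real (symbol t) - l))\<^sup>2 > 0" by auto
      have "(\<lambda>k. c / (1 + real k * d) * e) \<longlonglongrightarrow> 0" if "d > 0" for c d e :: real
        using that by real_asymp
      from this[OF d] show ?case .
    qed
  qed auto
  then show ?thesis by (simp add: spec_int_def)
qed

text \<open>
  Let \<open>G N\<close> be the expansion of the \<open>N\<close>-th truncation of \<open>x\<close>.  Away from the level set of \<open>l\<close> the function
  \<open>G N\<close> is small because \<open>(symbol - l) G N\<close> tends to \<open>0\<close> in norm; near the level set it is
  close to a fixed \<open>G M\<close>, whose mass there is small.
\<close>

theorem hilbert_matrix_no_eigenvector:
  assumes eig: "hilbert_matrix x = l *\<^sub>C x"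
  shows "x = 0"
proof (rule ccontr)
  assume "x \<noteq> 0"
  define c where "c = (norm x)\<^sup>2"
  have c: "c > 0" using \<open>x \<noteq> 0\<close> by (simp add: c_def)
  define u where "u = ell2_coord x"
  define G where "G N = expand_hahn N u" for N
  have lim: "(\<lambda>N. trunc N u) \<longlonglongrightarrow> x" unfolding u_def by (rule trunc_tendsto)
  have "\<exists>M. \<forall>N\<ge>M. norm (trunc N u - x) < sqrt c / 8"
    using LIMSEQ_D[OF lim, of "sqrt c / 8"] c by simp
  then obtain M where M: "\<And>N. N \<ge> M \<Longrightarrow> norm (trunc N u - x) < sqrt c / 8" by blast
  have close: "(norm (trunc N u - trunc M u))\<^sup>2 \<le> c / 16" if "N \<ge> M" for N
  proof -
    have "norm (trunc N u - trunc M u) \<le> norm (trunc N u - x) + norm (trunc M u - x)"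
      using norm_triangle_ineq4[of "trunc N u - x" "trunc M u - x"] by simp
    also have "\<dots> \<le> sqrt c / 4" using M[OF that] M[of M] by simp
    finally have "(norm (trunc N u - trunc M u))\<^sup>2 \<le> (sqrt c / 4)\<^sup>2" by (intro power_mono) auto
    then show ?thesis using c by (simp add: power_divide)
  qed
  define d where "d t = (norm (complex_of_real (symbol t) - l))\<^sup>2" for t
  have d: "d t \<ge> 0" "subexp d" for t
    unfolding d_def[abs_def] by (simp, intro csubexp_rules)
  have cut: "subexp (\<lambda>t. (norm (G M t))\<^sup>2 / (1 + real k * d t))" for k
  proof -
    have "1 + real k * d t \<ge> 1" for t using d(1)[of t] by simp
    then have "subexp (\<lambda>t. 1 / (1 + real k * d t))"
      using d(2) unfolding subexp_def[of d]
      by (intro subexp_bounded[where B = 1] continuous_intros)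
        (auto simp: divide_le_eq abs_le_iff, smt (verit))+
    then have "subexp (\<lambda>t. (norm (G M t))\<^sup>2 * (1 / (1 + real k * d t)))"
      unfolding G_def by (intro csubexp_rules)
    then show ?thesis by simp
  qed
  have "(\<lambda>k. spec_int (\<lambda>t. (norm (G M t))\<^sup>2 / (1 + real k * d t))) \<longlonglongrightarrow> 0"
    unfolding d_def G_def by (intro cutoff_tendsto csubexp_rules) simp
  then have "\<forall>\<^sub>F k in sequentially. spec_int (\<lambda>t. (norm (G M t))\<^sup>2 / (1 + real k * d t)) < c / 16"
    using c by (intro order_tendstoD) auto
  then obtain k where k: "spec_int (\<lambda>t. (norm (G M t))\<^sup>2 / (1 + real k * d t)) < c / 16"
    using eventually_happens'[OF sequentially_bot] by blast
  define e where "e N = (norm (hilbert_matrix (trunc N u) - l *\<^sub>C trunc N u))\<^sup>2" for N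
  have est: "(norm (trunc N u))\<^sup>2 \<le> real k * e N + c / 4" if N: "N \<ge> M" for N
  proof -
    \<comment> \<open>The weight 1 / (1 + k d) selects a neighbourhood of the level set; off it the factor k d / (1 + k d) is at most k d.\<close>
    have pt: "(norm (G N t))\<^sup>2 \<le> real k * (norm ((of_real (symbol t) - l) * G N t))\<^sup>2
        + 2 * (norm (G N t - G M t))\<^sup>2 + 2 * ((norm (G M t))\<^sup>2 / (1 + real k * d t))" for t
    proof -
      define y where "y = real k * d t"
      have y: "y \<ge> 0" by (simp add: y_def d)
      define a b where "a = (norm (G N t))\<^sup>2" and "b = 2 * (norm (G N t - G M t))\<^sup>2"
      have ab: "a \<ge> 0" "b \<ge> 0" by (simp_all add: a_def b_def)
      have "a \<le> b + 2 * (norm (G M t))\<^sup>2"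
        unfolding a_def b_def by (rule norm_sq_split)
      then have "a / (1 + y) \<le> (b + 2 * (norm (G M t))\<^sup>2) / (1 + y)"
        using y by (intro divide_right_mono) auto
      also have "\<dots> = b / (1 + y) + 2 * ((norm (G M t))\<^sup>2 / (1 + y))"
        by (simp add: add_divide_distrib)
      also have "b / (1 + y) \<le> b / 1" using y ab by (intro divide_left_mono) auto
      finally have 1: "a / (1 + y) \<le> b + 2 * ((norm (G M t))\<^sup>2 / (1 + y))" by simp
      have "a = a * (1 + y) / (1 + y)" using y by simp
      also have "\<dots> = a / (1 + y) + y * a / (1 + y)"
        by (simp add: distrib_left add_divide_distrib mult.commute)
      also have "y * a / (1 + y) \<le> y * a / 1" using y ab by (intro divide_left_mono) auto
      finally have "a \<le> y * a + (b + 2 * ((norm (G M t))\<^sup>2 / (1 + y)))" using 1 by simp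
      then show ?thesis
        by (simp add: a_def b_def y_def d_def norm_mult power_mult_distrib mult_ac)
    qed
    have "(norm (trunc N u))\<^sup>2 = spec_int (\<lambda>t. (norm (G N t))\<^sup>2)"
      unfolding G_def by (rule isometry_id[symmetric])
    also have "\<dots> \<le> spec_int (\<lambda>t. real k * (norm ((of_real (symbol t) - l) * G N t))\<^sup>2
        + 2 * (norm (G N t - G M t))\<^sup>2 + 2 * ((norm (G M t))\<^sup>2 / (1 + real k * d t)))"
      unfolding G_def by (rule spec_int_mono[OF _ _ pt[unfolded G_def]]; intro csubexp_rules cut[unfolded G_def])
    also have "\<dots> = real k * e N + 2 * (norm (trunc N u - trunc M u))\<^sup>2
        + 2 * spec_int (\<lambda>t. (norm (G M t))\<^sup>2 / (1 + real k * d t))"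
      unfolding e_def isometry_minus[symmetric] isometry_diff[OF N, symmetric] spec_int_cmult[symmetric]
      unfolding G_def
      by (subst spec_int_add, (intro csubexp_rules cut[unfolded G_def])+)+ simp
    also have "\<dots> \<le> real k * e N + c / 4" using close[OF N] k by simp
    finally show ?thesis .
  qed
  have "e \<longlonglongrightarrow> (norm (hilbert_matrix x - l *\<^sub>C x))\<^sup>2"
    unfolding e_def[abs_def]
    by (intro tendsto_intros tendsto_hilbert_matrix tendsto_scaleC lim)
  then have e0: "e \<longlonglongrightarrow> 0" by (simp add: eig)
  have "(\<lambda>N. (norm (trunc N u))\<^sup>2) \<longlonglongrightarrow> c"
    unfolding c_def by (intro tendsto_intros lim)
  moreover have "(\<lambda>N. real k * e N + c / 4) \<longlonglongrightarrow> real k * 0 + c / 4"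
    by (intro tendsto_intros e0)
  ultimately have "c \<le> real k * 0 + c / 4"
    using est by (intro LIMSEQ_le) auto
  then show False using c by simp
qed

section \<open>The interval belongs to the spectrum\<close>

lemma symbol_Lipschitz: "\<bar>symbol t - symbol s\<bar> \<le> pi\<^sup>2 * \<bar>t - s\<bar>"
proof -
  have deriv: "(symbol has_field_derivative - (pi\<^sup>2 * (sinh (pi * t) / (cosh (pi * t))\<^sup>2))) (at t within UNIV)" for t
    unfolding symbol_def[abs_def]
    by (auto intro!: derivative_eq_intros simp: power2_eq_square)
  have bound: "norm (- (pi\<^sup>2 * (sinh (pi * t) / (cosh (pi * t))\<^sup>2))) \<le> pi\<^sup>2" for t
  proof -
    have "\<bar>sinh (pi * t)\<bar> \<le> cosh (pi * t)"
      using sinh_le_cosh_real[of "pi * t"] sinh_le_cosh_real[of "- (pi * t)"]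
      by (simp add: abs_le_iff)
    also have "\<dots> \<le> (cosh (pi * t))\<^sup>2"
      using cosh_real_ge_1[of "pi * t"] by (simp add: power2_eq_square mult_le_cancel_left1)
    finally have "\<bar>sinh (pi * t)\<bar> / (cosh (pi * t))\<^sup>2 \<le> 1" by (simp add: divide_le_eq)
    then have "pi\<^sup>2 * (\<bar>sinh (pi * t)\<bar> / (cosh (pi * t))\<^sup>2) \<le> pi\<^sup>2 * 1"
      by (intro mult_left_mono) auto
    then show ?thesis by (simp add: abs_mult)
  qed
  show ?thesis
    using field_differentiable_bound[OF convex_UNIV deriv bound, of t s] by simp
qed

lemma weight_lower_bound:
  assumes "s > 0" "s \<le> t" "t \<le> s + 1"
  shows "pi * s * sinh (pi * s) / (cosh (pi * (s + 1)))\<^sup>2 \<le> weight t"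
  unfolding weight_def
proof (intro frac_le mult_mono power_mono)
  show "sinh (pi * s) \<le> sinh (pi * t)" using assms by simp
  show "cosh (pi * t) \<le> cosh (pi * (s + 1))"
    using assms by (subst cosh_real_nonneg_le_iff) (auto intro!: mult_left_mono)
qed (use assms in auto)

text \<open>
  The first basis vector is represented by the constant \<open>1\<close>, so a solution \<open>x\<close> is represented by
  \<open>1 / (symbol - l)\<close>.  On an interval of length \<open>d\<close> at \<open>s\<close> this function is at least of order \<open>1 / d\<close>, while the
  interval has mass at least \<open>c d\<close>; letting \<open>d\<close> tend to \<open>0\<close> contradicts the finiteness of the norm.
\<close>

lemma no_preimage_of_first_basis_vector:
  assumes s: "s > 0" and x: "hilbert_matrix x - of_real (symbol s) *\<^sub>C x = trunc 1 (\<lambda>_. 1)"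
  shows False
proof -
  define c where "c = pi * s * sinh (pi * s) / (cosh (pi * (s + 1)))\<^sup>2"
  have c: "c > 0" using s by (simp add: c_def)
  define l where "l = complex_of_real (symbol s)"
  define u where "u = ell2_coord x"
  define G where "G N = expand_hahn N u" for N
  define K where "K = (norm x)\<^sup>2"
  define e0 where "e0 = trunc 1 (\<lambda>_. 1)"
  define err where "err N = (norm (hilbert_matrix (trunc N u) - l *\<^sub>C trunc N u - e0))\<^sup>2" for N
  have err: "spec_int (\<lambda>t. (norm ((of_real (symbol t) - l) * G N t - 1))\<^sup>2) = err N" if "N \<ge> 1" for N
  proof -
    define U where "U n = - l * u n - (if n = 0 then 1 else 0)" for n :: nat
    have "expand_hahn N U t = - l * G N t - 1" for t
    proof -
      have "expand_hahn N U t = - l * G N t - (\<Sum>n<N. (if n = 0 then 1 else 0) * of_real (hahn n t))"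
        by (simp add: expand_hahn_def U_def G_def left_diff_distrib sum_subtractf sum_distrib_left sum_negf mult.assoc)
      also have "(\<Sum>n<N. (if n = 0 then 1 else 0) * of_real (hahn n t)) = (\<Sum>n<N. if n = 0 then complex_of_real (hahn n t) else 0)"
        by (intro sum.cong) auto
      also have "\<dots> = 1" using that by (simp add: hahn_0)
      finally show ?thesis .
    qed
    moreover have "trunc N U + hilbert_matrix (trunc N u) = hilbert_matrix (trunc N u) - l *\<^sub>C trunc N u - e0"
      using that by (intro ell2_eqI) (auto simp: ell2_coord_simps U_def e0_def)
    moreover have "- l * G N t - 1 + of_real (symbol t) * expand_hahn N u t = (of_real (symbol t) - l) * G N t - 1" for t
      by (simp add: G_def algebra_simps)
    ultimately show ?thesis
      using isometry[of N U u] unfolding err_def by (simp only:)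
  qed
  have lim: "(\<lambda>N. trunc N u) \<longlonglongrightarrow> x" unfolding u_def by (rule trunc_tendsto)
  have "err \<longlonglongrightarrow> (norm (hilbert_matrix x - l *\<^sub>C x - e0))\<^sup>2"
    unfolding err_def[abs_def]
    by (intro tendsto_intros tendsto_hilbert_matrix tendsto_scaleC lim)
  then have err0: "err \<longlonglongrightarrow> 0" using x by (simp add: l_def e0_def)
  have norm_G: "spec_int (\<lambda>t. (norm (G N t))\<^sup>2) \<le> K" for N
  proof -
    have "(\<lambda>n. if n \<in> {..<N} then (norm (u n))\<^sup>2 else 0) sums (\<Sum>n<N. (norm (u n))\<^sup>2)"
      by (rule sums_If_finite_set) simp
    also have "(\<lambda>n. if n \<in> {..<N} then (norm (u n))\<^sup>2 else 0) = (\<lambda>n. (norm (ell2_coord (trunc N u) n))\<^sup>2)"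
      by (auto simp: trunc.rep_eq)
    finally have "(norm (trunc N u))\<^sup>2 = (\<Sum>n<N. (norm (u n))\<^sup>2)" by (rule ell2_norm_eqI)
    then show ?thesis
      using ell2_partial_sum_le[of "{..<N}" x] by (simp add: G_def isometry_id u_def K_def)
  qed
  have main: "c * d \<le> 2 * (pi\<^sup>2 * d)\<^sup>2 * K" if d: "0 < d" "d \<le> 1" for d
  proof -
    have est: "c * d \<le> 2 * (pi\<^sup>2 * d)\<^sup>2 * K + 2 * err N" if N: "N \<ge> 1" for N
    proof -
      define F where "F t = 2 * (pi\<^sup>2 * d)\<^sup>2 * (norm (G N t))\<^sup>2
          + 2 * (norm ((of_real (symbol t) - l) * G N t - 1))\<^sup>2" for t
      have F: "subexp F" unfolding F_def[abs_def] G_def by (intro csubexp_rules)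
      have "c * d = (\<integral>t. indicator {s..s + d} t *\<^sub>R c \<partial>lborel)"
        using d by simp
      also have "\<dots> \<le> (\<integral>t. F t * weight t \<partial>lborel)"
      proof (rule integral_mono)
        show "integrable lborel (\<lambda>t. indicator {s..s + d} t *\<^sub>R c)"
          using d by (intro integrable_scaleR_left integrable_real_indicator) auto
        show "integrable lborel (\<lambda>t. F t * weight t)" by (rule integrable_subexp_weight[OF F])
        fix t
        have F0: "F t \<ge> 0" by (simp add: F_def)
        show "indicator {s..s + d} t *\<^sub>R c \<le> F t * weight t"
        proof (cases "t \<in> {s..s + d}")
          case True
          have "c \<le> weight t" unfolding c_def using True d s by (intro weight_lower_bound) auto
          moreover have "1 \<le> F t"
          proof -
            have "\<bar>symbol t - symbol s\<bar> \<le> pi\<^sup>2 * \<bar>t - s\<bar>" by (rule symbol_Lipschitz)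
            also have "\<dots> \<le> pi\<^sup>2 * d" using True by (intro mult_left_mono) auto
            finally have "norm (of_real (symbol t) - l) \<le> pi\<^sup>2 * d"
              unfolding l_def by (simp flip: of_real_diff)
            then have "(norm (of_real (symbol t) - l))\<^sup>2 \<le> (pi\<^sup>2 * d)\<^sup>2" by (intro power_mono) auto
            then have "(norm (of_real (symbol t) - l))\<^sup>2 * (norm (G N t))\<^sup>2 \<le> (pi\<^sup>2 * d)\<^sup>2 * (norm (G N t))\<^sup>2"
              by (intro mult_right_mono) auto
            then have "(norm ((of_real (symbol t) - l) * G N t))\<^sup>2 \<le> (pi\<^sup>2 * d)\<^sup>2 * (norm (G N t))\<^sup>2"
              by (simp only: norm_mult power_mult_distrib)
            moreover have "(norm (1::complex))\<^sup>2 \<le> 2 * (norm (1 - (of_real (symbol t) - l) * G N t))\<^sup>2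
                + 2 * (norm ((of_real (symbol t) - l) * G N t))\<^sup>2"
              by (rule norm_sq_split)
            ultimately show ?thesis by (simp add: F_def norm_minus_commute)
          qed
          ultimately have "1 * c \<le> F t * weight t" using c by (intro mult_mono) auto
          then show ?thesis using True by simp
        qed (use F0 weight_nonneg in auto)
      qed
      also have "\<dots> = spec_int F" by (simp add: spec_int_def)
      also have "\<dots> = 2 * (pi\<^sup>2 * d)\<^sup>2 * spec_int (\<lambda>t. (norm (G N t))\<^sup>2) + 2 * err N"
        unfolding err[OF N, symmetric] spec_int_cmult[symmetric] F_def[abs_def]
        unfolding G_def by (intro spec_int_add csubexp_rules)
      also have "\<dots> \<le> 2 * (pi\<^sup>2 * d)\<^sup>2 * K + 2 * err N"
        using norm_G by (intro add_right_mono mult_left_mono) auto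
      finally show ?thesis .
    qed
    have "(\<lambda>N. 2 * (pi\<^sup>2 * d)\<^sup>2 * K + 2 * err N) \<longlonglongrightarrow> 2 * (pi\<^sup>2 * d)\<^sup>2 * K + 2 * 0"
      by (intro tendsto_intros err0)
    then have "c * d \<le> 2 * (pi\<^sup>2 * d)\<^sup>2 * K + 2 * 0"
      by (rule LIMSEQ_le_const) (use est in blast)
    then show ?thesis by simp
  qed
  have "c \<le> 2 * pi ^ 4 * K * d" if d: "0 < d" "d \<le> 1" for d
  proof -
    have "c * d \<le> (2 * pi ^ 4 * K * d) * d"
      using main[OF d] by (simp add: power_mult_distrib power2_eq_square power4_eq_xxxx mult_ac)
    then show ?thesis using d by simp
  qed
  then have "\<forall>\<^sub>F d in at_right 0. c \<le> 2 * pi ^ 4 * K * d"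
    by (auto simp: eventually_at_right_field intro!: exI[of _ 1])
  moreover have "((\<lambda>d. 2 * pi ^ 4 * K * d) \<longlongrightarrow> 2 * pi ^ 4 * K * 0) (at_right 0)"
    by (intro tendsto_intros)
  ultimately have "c \<le> 2 * pi ^ 4 * K * 0"
    using tendsto_lowerbound[OF _ _ trivial_limit_at_right_real] by blast
  then show False using c by simp
qed

text \<open>
  Values of the symbol at positive arguments fill only the open interval.  For a point \<open>l\<close> of the closed interval
  in the resolvent set, the equation \<open>H x - p x = e\<^sub>0\<close> for a nearby \<open>p\<close> in the
  open interval would be solvable as a fixed point equation \<open>x = S (e\<^sub>0 + (p - l) x)\<close> with the resolvent \<open>S\<close>.
\<close>

lemma interval_subset_spectrum: "of_real ` {0..pi} \<subseteq> spectrum hilbert_matrix"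
proof (rule subsetI, rule ccontr)
  fix l assume "l \<in> complex_of_real ` {0..pi}" "l \<notin> spectrum hilbert_matrix"
  then obtain r where r: "0 \<le> r" "r \<le> pi" "l = of_real r" by auto
  obtain S where S: "bounded_clinear S" "\<And>x. hilbert_matrix (S x) - l *\<^sub>C S x = x"
    using \<open>l \<notin> _\<close> by (auto simp: spectrum_def resolvent_set_def)
  then have bl: "bounded_linear S" by (simp add: bounded_clinear_def)
  obtain K where K: "K > 0" "\<And>x. norm (S x) \<le> norm x * K"
    using bounded_linear.pos_bounded[OF bl] by blast
  define d where "d = min (1 / (2 * K)) (pi / 4)"
  have d: "d > 0" "d \<le> pi / 4" "d * K \<le> 1 / 2"
    using K by (auto simp: d_def min_def field_simps)
  define p where "p = (if r \<le> pi / 2 then r + d else r - d)"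
  have p: "0 < p" "p < pi" "\<bar>p - r\<bar> = d"
    using d r by (auto simp: p_def)
  define s where "s = arcosh (pi / p) / pi"
  have "pi / p > 1" using p by (simp add: field_simps)
  then have "arcosh (pi / p) > 0"
    using arcosh_real_gt_1_iff[of "pi / p"] by linarith
  then have s: "s > 0" by (simp add: s_def)
  have "pi * s = arcosh (pi / p)" by (simp add: s_def)
  then have "cosh (pi * s) = pi / p"
    using cosh_arcosh_real[of "pi / p"] \<open>pi / p > 1\<close> by (simp only: less_imp_le)
  then have sym: "symbol s = p" using p by (simp add: symbol_def)
  define e0 where "e0 = trunc 1 (\<lambda>_. 1)"
  obtain x where x: "S (e0 + of_real (p - r) *\<^sub>C x) = x"
  proof (rule contraction_fixed_point[where f = "\<lambda>x. S (e0 + of_real (p - r) *\<^sub>C x)" and q = "1/2"])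
    fix x y
    have "S (e0 + of_real (p - r) *\<^sub>C x) - S (e0 + of_real (p - r) *\<^sub>C y) = S (of_real (p - r) *\<^sub>C (x - y))"
      by (simp add: linear_diff[OF bounded_linear.linear[OF bl], symmetric] scaleC_diff_right)
    then have "norm (S (e0 + of_real (p - r) *\<^sub>C x) - S (e0 + of_real (p - r) *\<^sub>C y)) \<le> d * norm (x - y) * K"
      using K(2)[of "of_real (p - r) *\<^sub>C (x - y)"] p(3) by (simp add: norm_scaleC del: of_real_diff)
    also have "\<dots> = (d * K) * norm (x - y)" by simp
    also have "\<dots> \<le> 1 / 2 * norm (x - y)" using d by (intro mult_right_mono) auto
    finally show "norm (S (e0 + of_real (p - r) *\<^sub>C x) - S (e0 + of_real (p - r) *\<^sub>C y)) \<le> 1 / 2 * norm (x - y)" .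
  qed auto
  have "hilbert_matrix x - l *\<^sub>C x = e0 + of_real (p - r) *\<^sub>C x"
    using S(2)[of "e0 + of_real (p - r) *\<^sub>C x"] unfolding x .
  then have "hilbert_matrix x - of_real (symbol s) *\<^sub>C x = trunc 1 (\<lambda>_. 1)"
    unfolding r(3) sym e0_def[symmetric] by (simp add: scaleC_of_real algebra_simps del: of_real_diff)
  then show False by (rule no_preimage_of_first_basis_vector[OF s])
qed

section \<open>The spectrum lies in the interval\<close>

text \<open>
  A point outside the segment is strictly separated from it by a line.
\<close>

lemma separating_multiplier:
  assumes "l \<notin> complex_of_real ` {0..pi}"
  obtains b m where "m > 0" "\<And>r. r \<in> {0..pi} \<Longrightarrow> m \<le> Re (b * (of_real r - l))"
proof -
  \<comment> \<open>Multiplication by b rotates the segment, translated by - l, into the open right half-plane.\<close>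
  consider "Im l \<noteq> 0" | "Im l = 0" "Re l < 0" | "Im l = 0" "Re l > pi"
    using assms by (force simp: complex_eq_iff image_iff)
  then show ?thesis
  proof cases
    case 1
    show ?thesis by (rule that[of "Im l * Im l" "\<i> * of_real (Im l)"]) (use 1 in \<open>auto simp: zero_less_mult_iff linorder_neq_iff\<close>)
  next
    case 2
    show ?thesis by (rule that[of "- Re l" 1]) (use 2 in auto)
  next
    case 3
    show ?thesis by (rule that[of "Re l - pi" "-1"]) (use 3 in auto)
  qed
qed

text \<open>
  With \<open>z = b (symbol - l)\<close>, the bounds \<open>Re z \<ge> m\<close> and \<open>|z| \<le> L\<close> give \<open>|1 - e z|\<^sup>2 \<le> 1 - 2 e m + e\<^sup>2 L\<^sup>2\<close>, and
  \<open>e = m / L\<^sup>2\<close> minimises the right-hand side.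
\<close>

lemma perturbed_identity_contracts:
  assumes "l \<notin> complex_of_real ` {0..pi}"
  obtains a q where "a \<noteq> 0" "0 \<le> q" "q < 1"
    "\<And>x. norm (x - a *\<^sub>C (hilbert_matrix x - l *\<^sub>C x)) \<le> q * norm x"
proof -
  obtain b m where b: "m > 0" "\<And>r. r \<in> {0..pi} \<Longrightarrow> m \<le> Re (b * (of_real r - l))"
    using separating_multiplier[OF assms] by blast
  define L where "L = norm b * (pi + norm l)"
  have L: "norm (b * (of_real r - l)) \<le> L" if "r \<in> {0..pi}" for r
    unfolding L_def norm_mult using that norm_triangle_ineq4[of "of_real r" l]
    by (intro mult_left_mono) auto
  have mL: "m \<le> L"
    using b(2)[of 0] L[of 0] complex_Re_le_cmod[of "b * (of_real 0 - l)"] by simp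
  then have Lpos: "L > 0" using b by simp
  define e where "e = m / L\<^sup>2"
  define q where "q = sqrt (1 - m\<^sup>2 / L\<^sup>2)"
  have "m\<^sup>2 \<le> L\<^sup>2" using mL b by (intro power_mono) auto
  then have q2: "q\<^sup>2 = 1 - m\<^sup>2 / L\<^sup>2" "q \<ge> 0" using Lpos by (auto simp: q_def)
  have q1: "q < 1" using b Lpos by (auto simp: q_def)
  define a where "a = of_real e * b"
  have pt: "norm (1 - a * (of_real r - l)) \<le> q" if r: "r \<in> {0..pi}" for r
  proof -
    define z where "z = b * (of_real r - l)"
    have "(norm (1 - a * (of_real r - l)))\<^sup>2 = (norm (1 - of_real e * z))\<^sup>2"
      by (simp add: a_def z_def mult.assoc)
    also have "\<dots> = 1 - 2 * e * Re z + e\<^sup>2 * (norm z)\<^sup>2"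
      unfolding cmod_power2 by (simp add: power2_eq_square algebra_simps)
    also have "\<dots> \<le> 1 - 2 * e * m + e\<^sup>2 * L\<^sup>2"
      using b(2)[OF r] L[OF r] b Lpos
      by (intro add_mono diff_mono mult_left_mono power_mono) (auto simp: z_def e_def)
    also have "\<dots> = q\<^sup>2"
      unfolding q2(1) using Lpos by (simp add: e_def power2_eq_square field_simps)
    finally show ?thesis by (rule power2_le_imp_le) (rule q2(2))
  qed
  have bound: "norm (trunc N u - a *\<^sub>C (hilbert_matrix (trunc N u) - l *\<^sub>C trunc N u)) \<le> q * norm (trunc N u)" for N u
  proof -
    have "trunc N u - a *\<^sub>C (hilbert_matrix (trunc N u) - l *\<^sub>C trunc N u)
        = (1 + a * l) *\<^sub>C trunc N u + (- a) *\<^sub>C hilbert_matrix (trunc N u)"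
      by (rule ell2_eqI) (simp add: ell2_coord_simps algebra_simps)
    then have "(norm (trunc N u - a *\<^sub>C (hilbert_matrix (trunc N u) - l *\<^sub>C trunc N u)))\<^sup>2
        = spec_int (\<lambda>t. (norm (((1 + a * l) + - a * of_real (symbol t)) * expand_hahn N u t))\<^sup>2)"
      by (simp only: isometry_affine)
    also have "\<dots> \<le> spec_int (\<lambda>t. q\<^sup>2 * (norm (expand_hahn N u t))\<^sup>2)"
    proof (rule spec_int_mono)
      fix t
      have "norm ((1 + a * l) + - a * of_real (symbol t)) = norm (1 - a * (of_real (symbol t) - l))"
        by (simp add: algebra_simps)
      also have "\<dots> \<le> q" using symbol_pos[of t] symbol_le[of t] by (intro pt) auto
      finally have "(norm ((1 + a * l) + - a * of_real (symbol t)))\<^sup>2 \<le> q\<^sup>2" by (intro power_mono) auto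
      then show "(norm (((1 + a * l) + - a * of_real (symbol t)) * expand_hahn N u t))\<^sup>2
          \<le> q\<^sup>2 * (norm (expand_hahn N u t))\<^sup>2"
        unfolding norm_mult power_mult_distrib by (intro mult_right_mono) auto
    qed (intro csubexp_rules)+
    also have "\<dots> = (q * norm (trunc N u))\<^sup>2"
      by (simp add: spec_int_cmult isometry_id power_mult_distrib)
    finally show ?thesis by (rule power2_le_imp_le) (use q2(2) in simp)
  qed
  have "norm (x - a *\<^sub>C (hilbert_matrix x - l *\<^sub>C x)) \<le> q * norm x" for x
  proof (rule LIMSEQ_le)
    let ?X = "\<lambda>N. trunc N (ell2_coord x)"
    show "(\<lambda>N. norm (?X N - a *\<^sub>C (hilbert_matrix (?X N) - l *\<^sub>C ?X N)))
        \<longlonglongrightarrow> norm (x - a *\<^sub>C (hilbert_matrix x - l *\<^sub>C x))"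
      by (intro tendsto_intros tendsto_hilbert_matrix tendsto_scaleC trunc_tendsto)
    show "(\<lambda>N. q * norm (?X N)) \<longlonglongrightarrow> q * norm x"
      by (intro tendsto_intros trunc_tendsto)
  qed (use bound in blast)
  moreover have "a \<noteq> 0"
  proof
    assume "a = 0"
    then show False using pt[of 0] q1 by (simp del: of_real_0)
  qed
  ultimately show ?thesis using that q2 q1 by blast
qed

text \<open>
  The contraction estimate bounds \<open>H - l\<close> from below and makes
  \<open>x \<mapsto> x - a ((H - l) x - y)\<close> a contraction, whose fixed point solves \<open>(H - l) x = y\<close>.
\<close>

lemma spectrum_subset_interval: "spectrum hilbert_matrix \<subseteq> complex_of_real ` {0..pi}"
proof (rule subsetI, rule ccontr)
  fix l assume l: "l \<in> spectrum hilbert_matrix" "l \<notin> complex_of_real ` {0..pi}"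
  define A where "A x = hilbert_matrix x - l *\<^sub>C x" for x
  obtain a q where a: "a \<noteq> 0" and q: "0 \<le> q" "q < 1"
    and contr: "\<And>x. norm (x - a *\<^sub>C A x) \<le> q * norm x"
    using perturbed_identity_contracts[OF l(2)] unfolding A_def by blast
  have A: "bounded_linear A"
    unfolding A_def[abs_def] by (intro bounded_linear_sub bounded_linear_hilbert_matrix bounded_linear_scaleC)
  have A_diff: "A (x - y) = A x - A y" for x y
    by (rule linear_diff[OF bounded_linear.linear[OF A]])
  have A_scaleC: "A (c *\<^sub>C x) = c *\<^sub>C A x" for c x
    by (rule ell2_eqI) (simp add: A_def hilbert_matrix_scaleC ell2_coord_simps algebra_simps)
  have below: "(1 - q) * norm x \<le> norm a * norm (A x)" for x
    using norm_triangle_ineq2[of x "a *\<^sub>C A x"] contr[of x] norm_triangle_ineq2[of x "x - a *\<^sub>C A x"]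
    by (simp add: norm_scaleC algebra_simps)
  have inj: "x = y" if "A x = A y" for x y
    using below[of "x - y"] that q by (simp add: A_diff mult_le_0_iff)
  have surj: "\<exists>x. A x = y" for y
  proof -
    obtain x where x: "x - a *\<^sub>C (A x - y) = x"
    proof (rule contraction_fixed_point[where f = "\<lambda>x. x - a *\<^sub>C (A x - y)" and q = q])
      fix x x'
      have "x - a *\<^sub>C (A x - y) - (x' - a *\<^sub>C (A x' - y)) = (x - x') - a *\<^sub>C A (x - x')"
        by (simp add: A_diff scaleC_diff_right)
      then show "norm (x - a *\<^sub>C (A x - y) - (x' - a *\<^sub>C (A x' - y))) \<le> q * norm (x - x')"
        by (simp only: contr)
    qed (use q in auto)
    then have "a *\<^sub>C (A x - y) = 0" by simp
    then have "norm a * norm (A x - y) = 0" by (metis norm_scaleC norm_zero)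
    then show ?thesis using a by auto
  qed
  define S where "S = inv A"
  have AS: "A (S y) = y" for y
    unfolding S_def using surj[of y] by (metis f_inv_into_f rangeI)
  have SA: "S (A x) = x" for x using inj AS by blast
  have "bounded_clinear S"
    unfolding bounded_clinear_def
  proof (intro conjI allI)
    show "bounded_linear S"
    proof (rule bounded_linear_intro[where K = "norm a / (1 - q)"])
      fix x y and r :: real
      show "S (x + y) = S x + S y"
        by (rule inj) (simp add: AS linear_add[OF bounded_linear.linear[OF A]])
      show "S (r *\<^sub>R x) = r *\<^sub>R S x"
        by (rule inj) (simp add: AS linear_scale[OF bounded_linear.linear[OF A]])
      show "norm (S x) \<le> norm x * (norm a / (1 - q))"
        using below[of "S x"] q by (simp add: AS field_simps)
    qed
    show "S (c *\<^sub>C x) = c *\<^sub>C S x" for c x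
      by (rule inj) (simp add: AS A_scaleC)
  qed
  then have "l \<in> resolvent_set hilbert_matrix"
    unfolding resolvent_set_def using SA AS by (auto simp: A_def)
  then show False using l(1) by (simp add: spectrum_def)
qed

theorem mainTheorem2:
  shows "spectrum hilbert_matrix = complex_of_real ` {0..pi} \<and> point_spectrum hilbert_matrix = {}"
proof
  show "spectrum hilbert_matrix = complex_of_real ` {0..pi}"
    using spectrum_subset_interval interval_subset_spectrum by blast
  show "point_spectrum hilbert_matrix = {}"
    using hilbert_matrix_no_eigenvector by (auto simp: point_spectrum_def)
qed

end
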